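(* Let $P$ and $\widehat K$ be the transfer functions of a plant and a controller, and let $$\widehat P_{CL}(s)=\frac{P(s)\widehat K(s)}{1+P(s)\widehat K(s)},\qquad \widehat E(s)=\frac{1}{1+P(s)\widehat K(s)}$$ be the closed-loop transfer function (from the reference $r$ to the output $y$) and the sensitivity transfer function (from $r$ to the error $\epsilon=r-y$) of the negative feedback loop formed by $P$ and $\widehat K$. Assume that $\widehat P_{CL}$, and implicitly $\widehat E$, are asymptotically stable. Let the reference $r(t)$ be the output $\theta(t)$ of the signal generator $\dot\omega=S\omega$, $\theta=L\omega$, $\omega(0)\neq0$, with the pair $(L,S)$ observable. If $\dim\widehat P_{CL}=\dim\widehat E=\dim S$, then the following statements are equivalent: (1) $\widehat P_{CL}$ asymptotically tracks the reference $r(t)$. (2) The moments of $\widehat P_{CL}$ at $\sigma(S)$ are equal to the elements of $L$. (3) The moments of $\widehat E(s)$ at $\sigma(S)$ are equal to zero.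
   Context: All systems are linear, time-invariant and single-input single-output. $P$ is strictly proper, with minimal realization $P(s)=C(sI-A)^{-1}B$, and $\widehat K$ is a proper rational transfer function with a state-space realization. The disturbance is zero, the controller is driven by $\epsilon=r-y$, and its output is the plant input. $\dim$ of a transfer function is the number of states of its (minimal) state-space realization; $\dim S$ is the size of the square matrix $S$; $\sigma(S)$ is the set of eigenvalues of $S$. Signal generator: $S\in\mathbb{R}^{\nu\times\nu}$, $L\in\mathbb{R}^{1\times\nu}$, $\sigma(S)$ is contained in the imaginary axis, and $(L,S,\omega(0))$ is minimal, i.e. $(L,S)$ is observable and $\omega(0),S\omega(0),\dots,S^{\nu-1}\omega(0)$ span the state space. Asymptotically stable means that all eigenvalues of the state matrix of the realization have negative real part. Asymptotic tracking of $r(t)$ means that, for every initial state, $\lim_{t\to\infty}(r(t)-y(t))=0$. Moments: the $0$-moment of a transfer function $W$ at $s_1\in\mathbb{C}$ is $W(s_1)$ and, for $k\ge1$, the $k$-moment at $s_1$ is $\frac{(-1)^k}{k!}\frac{d^kW}{ds^k}(s_1)$. "The moments of $W$ at $\sigma(S)$" are the moments of orders $0,\dots,m_i-1$ at each eigenvalue $s_i$ of $S$, where $m_i$ is the multiplicity of $s_i$. For a strictly proper system with minimal realization $W(s)=C_W(sI-A_W)^{-1}B_W$ and $\sigma(A_W)\cap\sigma(S)=\emptyset$, with $(L,S)$ observable, these moments are represented by the row vector $C_W\Pi$, where $\Pi$ is the unique solution of $A_W\Pi+B_WL=\Pi S$. Statement (2) means that $C_W\Pi=L$ for $W=\widehat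 P_{CL}$. *)

theory Defs
  imports
    "HOL-Analysis.Derivative"
    "HOL-Computational_Algebra.Fraction_Field"
    "Jordan_Normal_Form.Gauss_Jordan_Elimination"
    "Jordan_Normal_Form.Spectral_Radius"
begin

text \<open>
  Transfer functions are elements of the field of real rational functions, so that
  \<^term>\<open>1 / (1 + P * K)\<close> is taken after all pole-zero cancellations. (Evaluating
  \<open>P\<close> and \<open>K\<close> pointwise first would break at the poles of the controller, which is
  exactly where the sensitivity is to be evaluated.)
\<close>

type_synonym tf = "real poly fract"

definition tf_const :: "real \<Rightarrow> tf" where
  "tf_const c = to_fract [:c:]"

definition tf_s :: tf where
  "tf_s = to_fract [:0, 1:]"

text \<open>
  The matrix \<open>sI - A\<close> is invertible over the field of rational functions, because its
  determinant is the characteristic polynomial of \<open>A\<close>; hence \<open>the\<close> is harmless.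
\<close>

definition transfer_function :: "real mat \<Rightarrow> real mat \<Rightarrow> real mat \<Rightarrow> real \<Rightarrow> tf" where
  "transfer_function A B C D =
     (map_mat tf_const C
        * the (mat_inverse (tf_s \<cdot>\<^sub>m 1\<^sub>m (dim_row A) - map_mat tf_const A))
        * map_mat tf_const B) $$ (0, 0)
     + tf_const D"

definition realization :: "real mat \<Rightarrow> real mat \<Rightarrow> real mat \<Rightarrow> real \<Rightarrow> tf \<Rightarrow> bool" where
  "realization A B C D W \<longleftrightarrow>
     A \<in> carrier_mat (dim_row A) (dim_row A) \<and>
     B \<in> carrier_mat (dim_row A) 1 \<and>
     C \<in> carrier_mat 1 (dim_row A) \<and>
     transfer_function A B C D = W"

definition tf_dim :: "tf \<Rightarrow> nat" where
  "tf_dim W = (LEAST n. \<exists>A B C D. realization A B C D W \<and> dim_row A = n)"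

definition minimal_realization ::
    "real mat \<Rightarrow> real mat \<Rightarrow> real mat \<Rightarrow> real \<Rightarrow> tf \<Rightarrow> bool" where
  "minimal_realization A B C D W \<longleftrightarrow> realization A B C D W \<and> dim_row A = tf_dim W"

text \<open>Eigenvalues of a real matrix are always complex eigenvalues here.\<close>

definition cspectrum :: "real mat \<Rightarrow> complex set" where
  "cspectrum A = spectrum (map_mat complex_of_real A)"

definition alg_multiplicity :: "real mat \<Rightarrow> complex \<Rightarrow> nat" where
  "alg_multiplicity A z = order z (char_poly (map_mat complex_of_real A))"

definition asymptotically_stable :: "real mat \<Rightarrow> bool" where
  "asymptotically_stable A \<longleftrightarrow> (\<forall>z\<in>cspectrum A. Re z < 0)"

definition observable :: "real mat \<Rightarrow> real mat \<Rightarrow> bool" where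
  "observable L S \<longleftrightarrow>
     (\<forall>x\<in>carrier_vec (dim_row S).
        (\<forall>k<dim_row S. (L * S ^\<^sub>m k) *\<^sub>v x = 0\<^sub>v 1) \<longrightarrow> x = 0\<^sub>v (dim_row S))"

definition excitable :: "real mat \<Rightarrow> real vec \<Rightarrow> bool" where
  "excitable S \<omega>\<^sub>0 \<longleftrightarrow>
     LinearCombinations.module.span class_ring (module_vec TYPE(real) (dim_row S))
       {S ^\<^sub>m k *\<^sub>v \<omega>\<^sub>0 | k. k < dim_row S} = carrier_vec (dim_row S)"

definition ode_solution :: "nat \<Rightarrow> (real \<Rightarrow> real vec \<Rightarrow> real vec) \<Rightarrow> (real \<Rightarrow> real vec) \<Rightarrow> bool" where
  "ode_solution n f x \<longleftrightarrow>
     (\<forall>t\<ge>0. x t \<in> carrier_vec n \<and>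
        (\<forall>i<n. ((\<lambda>\<tau>. vec_index (x \<tau>) i) has_real_derivative vec_index (f t (x t)) i)
                 (at t within {0..})))"

text \<open>
  Tracking is a property of a concrete realization: initial states of modes that are invisible
  in the transfer function also have to be forgotten. Besides the minimal realization of a
  closed-loop transfer function, this covers the interconnection of the realizations of plant
  and controller.
\<close>

definition asymptotically_tracks ::
    "real mat \<Rightarrow> real mat \<Rightarrow> real mat \<Rightarrow> real \<Rightarrow> (real \<Rightarrow> real) \<Rightarrow> bool" where
  "asymptotically_tracks A B C D r \<longleftrightarrow>
     (\<forall>x\<^sub>0\<in>carrier_vec (dim_row A). \<forall>x.
        x 0 = x\<^sub>0 \<and> ode_solution (dim_row A) (\<lambda>t v. A *\<^sub>v v + r t \<cdot>\<^sub>v col B 0) x \<longrightarrow>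
        ((\<lambda>t. r t - (vec_index (C *\<^sub>v x t) 0 + D * r t)) \<longlongrightarrow> 0) at_top)"

definition generator_trajectory :: "real mat \<Rightarrow> real vec \<Rightarrow> (real \<Rightarrow> real vec) \<Rightarrow> bool" where
  "generator_trajectory S \<omega>\<^sub>0 \<omega> \<longleftrightarrow>
     \<omega> 0 = \<omega>\<^sub>0 \<and> ode_solution (dim_row S) (\<lambda>t v. S *\<^sub>v v) \<omega>"

text \<open>
  The value does not depend on the fraction chosen, and one with nonvanishing denominator
  exists iff \<open>z\<close> is not a pole of \<open>W\<close>; at poles the value is unspecified.
\<close>

definition tf_eval :: "tf \<Rightarrow> complex \<Rightarrow> complex" where
  "tf_eval W z = (THE w. \<exists>p q. W = Fract p q \<and> poly (map_poly complex_of_real q) z \<noteq> 0 \<and>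
      w = poly (map_poly complex_of_real p) z / poly (map_poly complex_of_real q) z)"

definition moment :: "nat \<Rightarrow> tf \<Rightarrow> complex \<Rightarrow> complex" where
  "moment k W z = (-1) ^ k / fact k * (deriv ^^ k) (tf_eval W) z"

definition moments_vanish_at_spectrum :: "tf \<Rightarrow> real mat \<Rightarrow> bool" where
  "moments_vanish_at_spectrum W S \<longleftrightarrow>
     (\<forall>z\<in>cspectrum S. \<forall>k<alg_multiplicity S z. moment k W z = 0)"

definition sylvester_solution :: "real mat \<Rightarrow> real mat \<Rightarrow> real mat \<Rightarrow> real mat \<Rightarrow> real mat" where
  "sylvester_solution A B S L =
     (THE X. X \<in> carrier_mat (dim_row A) (dim_row S) \<and> A * X + B * L = X * S)"

end

theory Submission
  imports
    "HOL-Complex_Analysis.Cauchy_Integral_Formula"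
    "HOL-Computational_Algebra.Field_as_Ring"
    "HOL-Computational_Algebra.Polynomial_Factorial"
    "Subresultants.More_Homomorphisms"
    Defs
begin

text \<open>
  All three statements say that the characteristic polynomial \<open>\<chi>\<^sub>S\<close> of the generator divides
  the numerator of the sensitivity.

  Let \<open>(A, B, C)\<close> be a stable realization of the closed loop \<open>W\<close>, let \<open>\<chi>\<^sub>A\<close> be the
  characteristic polynomial of \<open>A\<close>, and write \<open>W = n / \<chi>\<^sub>A\<close>. Since \<open>1 + P K\<close> is not zero,
  \<open>E = 1 - W = q / \<chi>\<^sub>A\<close> with \<open>q = \<chi>\<^sub>A - n\<close>. The roots of \<open>\<chi>\<^sub>A\<close> lie in the open left half-plane
  and those of \<open>\<chi>\<^sub>S\<close> on the imaginary axis, so the two are coprime and \<open>\<chi>\<^sub>A(S)\<close> is invertible.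

  Moments of \<open>W\<close>: the adjugate gives polynomials \<open>g\<close> with \<open>(sI - A) g = \<chi>\<^sub>A B\<close>. Substituting \<open>S\<close>
  for \<open>s\<close> shows that the rows \<open>L g\<^sub>k(S) \<chi>\<^sub>A(S)\<^sup>-\<^sup>1\<close> form the solution \<open>X\<close> of the Sylvester
  equation, so that \<open>C X = L n(S) \<chi>\<^sub>A(S)\<^sup>-\<^sup>1\<close>. Hence \<open>C X = L\<close> iff \<open>L q(S) = 0\<close>, and for an
  observable pair this means that \<open>\<chi>\<^sub>S\<close> divides \<open>q\<close> (\<open>sylvester_moments_eq_iff_dvd\<close>).

  Moments of \<open>E\<close>: the denominator \<open>\<chi>\<^sub>A\<close> does not vanish on the spectrum of \<open>S\<close>, so the moments
  vanish iff \<open>q\<close> has a zero of order at least the multiplicity at each eigenvalue of \<open>S\<close>, that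
  is, iff \<open>\<chi>\<^sub>S\<close> divides \<open>q\<close> (\<open>moments_vanish_at_spectrum_iff_dvd\<close>).

  Tracking: \<open>x - X \<omega>\<close> solves the stable homogeneous equation for every trajectory \<open>x\<close>, so up to a
  vanishing transient the tracking error is \<open>(L - C X) \<omega>\<close>. This signal solves the differential
  equation with characteristic polynomial \<open>\<chi>\<^sub>S\<close>, whose modes do not decay; it can converge to
  zero only if it vanishes, and then \<open>C X = L\<close> because the generator is excited in every
  direction (\<open>tracking_iff_sylvester\<close>, \<open>excited_output_eq_0\<close>). Tracking may refer to a realization
  other than the minimal one; divisibility by \<open>\<chi>\<^sub>S\<close> is the same for the numerators of both.
\<close>

section \<open>Polynomial functionals and the Cayley--Hamilton theorem\<close>

text \<open>
  The linear functional on polynomials that sends \<open>s\<^sup>k\<close> to the \<open>k\<close>-th term of a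
  sequence. If the sequence is an entry of \<open>L S\<^sup>k\<close>, its value at \<open>p\<close> is the corresponding
  entry of \<open>L p(S)\<close>; if the sequence consists of the derivatives of a signal, its value is
  the differential operator \<open>p(d/dt)\<close> applied to the signal. Both readings are used below.
\<close>

definition seq_eval :: "(nat \<Rightarrow> 'a::comm_ring_1) \<Rightarrow> 'a poly \<Rightarrow> 'a" where
  "seq_eval y p = (\<Sum>k\<le>degree p. coeff p k * y k)"

lemma seq_eval_bound:
  assumes "degree p \<le> n"
  shows "seq_eval y p = (\<Sum>k\<le>n. coeff p k * y k)"
  unfolding seq_eval_def using assms
  by (intro sum.mono_neutral_left) (auto simp: not_le coeff_eq_0)

lemma seq_eval_add: "seq_eval y (p + q) = seq_eval y p + seq_eval y q"
proof -
  let ?n = "max (degree p) (degree q)"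
  have "degree (p + q) \<le> ?n" "degree p \<le> ?n" "degree q \<le> ?n"
    by (auto intro: degree_add_le_max)
  note this[THEN seq_eval_bound, of y]
  then show ?thesis
    by (simp only: sum.distrib distrib_right coeff_add)
qed

lemma seq_eval_0 [simp]: "seq_eval y 0 = 0"
  by (simp add: seq_eval_def)

lemma seq_eval_1 [simp]: "seq_eval y 1 = y 0"
  by (simp add: seq_eval_def)

lemma seq_eval_smult: "seq_eval y (Polynomial.smult c p) = c * seq_eval y p"
  unfolding seq_eval_bound[OF degree_smult_le] seq_eval_def[of y p]
  by (simp add: sum_distrib_left mult.assoc)

lemma seq_eval_minus: "seq_eval y (- p) = - seq_eval y p"
  using seq_eval_smult[of y "-1" p] by simp

lemma seq_eval_diff: "seq_eval y (p - q) = seq_eval y p - seq_eval y q"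
  using seq_eval_add[of y p "- q"] by (simp add: seq_eval_minus)

lemma seq_eval_sum: "seq_eval y (\<Sum>i\<in>I. f i) = (\<Sum>i\<in>I. seq_eval y (f i))"
  by (induction I rule: infinite_finite_induct) (auto simp: seq_eval_add)

lemma seq_eval_shift: "seq_eval y (pCons 0 p) = seq_eval (\<lambda>k. y (Suc k)) p"
proof -
  have "seq_eval y (pCons 0 p) = (\<Sum>k\<le>Suc (degree p). coeff (pCons 0 p) k * y k)"
    by (rule seq_eval_bound) (rule degree_pCons_le)
  also have "\<dots> = (\<Sum>k\<le>degree p. coeff p k * y (Suc k))"
    by (subst sum.atMost_Suc_shift) simp
  finally show ?thesis by (simp add: seq_eval_def)
qed

lemma seq_eval_lincomb:
  "seq_eval (\<lambda>k. \<Sum>i\<in>I. c i * y i k) p = (\<Sum>i\<in>I. c i * seq_eval (y i) p)"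
  unfolding seq_eval_def sum_distrib_left
  by (subst sum.swap) (simp add: algebra_simps)

lemma char_poly_nonzero: "A \<in> carrier_mat n n \<Longrightarrow> char_poly A \<noteq> 0"
  using degree_monic_char_poly[of A n] by auto

lemma char_poly_matrix_index:
  assumes "A \<in> carrier_mat n n" "i < n" "j < n"
  shows "char_poly_matrix A $$ (i, j) = (if i = j then [:0, 1:] else 0) - [:A $$ (i, j):]"
  using assms by (auto simp: char_poly_matrix_def)

lemma char_poly_matrix_times_adj_index:
  assumes A: "A \<in> carrier_mat n n" and ij: "i < n" "j < n"
  shows "(\<Sum>l<n. char_poly_matrix A $$ (i, l) * adj_mat (char_poly_matrix A) $$ (l, j))
       = (if i = j then char_poly A else 0)"
proof -
  let ?D = "char_poly_matrix A"
  have D: "?D \<in> carrier_mat n n" using A by simp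
  note adj = adj_mat[OF D, folded char_poly_def]
  have "(\<Sum>l<n. ?D $$ (i, l) * adj_mat ?D $$ (l, j)) = (?D * adj_mat ?D) $$ (i, j)"
    using ij D adj(1) by (auto simp: scalar_prod_def lessThan_atLeast0)
  also have "\<dots> = (if i = j then char_poly A else 0)"
    unfolding adj(2) using ij by simp
  finally show ?thesis .
qed

text \<open>
  Cayley--Hamilton for a family of sequences with a matrix recursion. The recursion says
  that the row of functionals \<open>seq_eval (u i)\<close> is annihilated by the columns of \<open>sI - M\<close>;
  multiplying on the right by the adjugate turns these relations into annihilation by
  \<open>det (sI - M)\<close>.
\<close>

lemma cayley_hamilton_seq:
  fixes M :: "'a::comm_ring_1 mat" and u :: "nat \<Rightarrow> nat \<Rightarrow> 'a"
  assumes M: "M \<in> carrier_mat n n"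
    and rec: "\<And>j k. j < n \<Longrightarrow> u j (Suc k) = (\<Sum>i<n. M $$ (i, j) * u i k)"
    and j: "j < n"
  shows "seq_eval (u j) (char_poly M * p) = 0"
proof -
  define D where "D = char_poly_matrix M"
  define G where "G = adj_mat D"
  note Dij = char_poly_matrix_index[OF M, folded D_def]
  have col: "(\<Sum>i<n. seq_eval (u i) (D $$ (i, l) * q)) = 0" if l: "l < n" for l q
  proof -
    have "(\<Sum>i<n. seq_eval (u i) (D $$ (i, l) * q))
        = (\<Sum>i<n. (if i = l then seq_eval (u i) (pCons 0 q) else 0) - M $$ (i, l) * seq_eval (u i) q)"
      by (intro sum.cong) (auto simp: Dij l left_diff_distrib seq_eval_diff seq_eval_smult)
    also have "\<dots> = seq_eval (u l) (pCons 0 q) - (\<Sum>i<n. M $$ (i, l) * seq_eval (u i) q)"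
      using l by (simp add: sum_subtractf)
    also have "\<dots> = 0"
      by (simp add: seq_eval_shift rec[OF l] seq_eval_lincomb)
    finally show ?thesis .
  qed
  have prod: "(\<Sum>l<n. D $$ (i, l) * G $$ (l, j)) = (if i = j then char_poly M else 0)" if "i < n" for i
    unfolding G_def D_def by (rule char_poly_matrix_times_adj_index[OF M that j])
  have "seq_eval (u j) (char_poly M * p)
      = (\<Sum>i<n. seq_eval (u i) ((if i = j then char_poly M else 0) * p))"
    using j by (subst sum.remove[of _ j]) (auto intro!: sum.neutral)
  also have "\<dots> = (\<Sum>i<n. \<Sum>l<n. seq_eval (u i) (D $$ (i, l) * (G $$ (l, j) * p)))"
    by (intro sum.cong refl) (simp add: prod[symmetric] sum_distrib_right seq_eval_sum mult.assoc)
  also have "\<dots> = (\<Sum>l<n. \<Sum>i<n. seq_eval (u i) (D $$ (i, l) * (G $$ (l, j) * p)))"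
    by (rule sum.swap)
  also have "\<dots> = 0"
    using col by simp
  finally show ?thesis .
qed

section \<open>Row vectors acted on by polynomials in a matrix\<close>

text \<open>
  The entries of \<open>M S\<^sup>k\<close> for a row vector \<open>M\<close>, as sequences in \<open>k\<close>; in terms of
  \<^const>\<open>seq_eval\<close>, the family over \<open>j\<close> is the row vector \<open>M p(S)\<close>.
\<close>

definition markov :: "real mat \<Rightarrow> real mat \<Rightarrow> nat \<Rightarrow> nat \<Rightarrow> real" where
  "markov M S j k = (M * S ^\<^sub>m k) $$ (0, j)"

lemma markov_Suc:
  assumes "M \<in> carrier_mat 1 n" "S \<in> carrier_mat n n" "j < n"
  shows "markov M S j (Suc k) = (\<Sum>i<n. S $$ (i, j) * markov M S i k)"
proof -
  have "M * S ^\<^sub>m Suc k = (M * S ^\<^sub>m k) * S"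
    using assms by (simp add: assoc_mult_mat[of _ 1 n _ n _ n])
  then show ?thesis
    using assms by (auto simp: markov_def scalar_prod_def lessThan_atLeast0 mult.commute intro!: sum.cong)
qed

lemma cayley_hamilton_markov:
  assumes "M \<in> carrier_mat 1 n" "S \<in> carrier_mat n n" "j < n"
  shows "seq_eval (markov M S j) (char_poly S * p) = 0"
  by (rule cayley_hamilton_seq[where u="markov M S"]) (use assms markov_Suc[OF assms(1,2)] in auto)

lemma seq_eval_markov_shift:
  assumes "M \<in> carrier_mat 1 n" "S \<in> carrier_mat n n" "j < n"
  shows "seq_eval (markov M S j) (pCons 0 p) = (\<Sum>i<n. S $$ (i, j) * seq_eval (markov M S i) p)"
  by (simp add: seq_eval_shift markov_Suc[OF assms] seq_eval_lincomb)

text \<open>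
  For an observable pair \<open>L p(S) = 0\<close> only when the characteristic polynomial divides
  \<open>p\<close>: by Cayley--Hamilton \<open>p\<close> may be replaced by its remainder, and the coefficients of the
  remainder are a linear dependence between the rows of the square observability matrix, whose
  kernel is trivial.
\<close>

lemma seq_eval_markov_0_iff_dvd:
  assumes L: "L \<in> carrier_mat 1 n" and S: "S \<in> carrier_mat n n" and obs: "observable L S"
  shows "(\<forall>j<n. seq_eval (markov L S j) p = 0) \<longleftrightarrow> char_poly S dvd p"
proof
  assume "char_poly S dvd p"
  then show "\<forall>j<n. seq_eval (markov L S j) p = 0"
    using cayley_hamilton_markov[OF L S] by (auto elim!: dvdE)
next
  assume 0: "\<forall>j<n. seq_eval (markov L S j) p = 0"
  define r where "r = p mod char_poly S"
  have deg: "degree (char_poly S) = n" "char_poly S \<noteq> 0"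
    using degree_monic_char_poly[OF S] char_poly_nonzero[OF S] by auto
  define O' where "O' = mat n n (\<lambda>(k, j). markov L S j k)"
  have O': "O' \<in> carrier_mat n n" by (simp add: O'_def)
  have "det O' \<noteq> 0"
  proof
    assume "det O' = 0"
    then obtain x where x: "x \<in> carrier_vec n" "x \<noteq> 0\<^sub>v n" "O' *\<^sub>v x = 0\<^sub>v n"
      using det_0_iff_vec_prod_zero_field[OF O'] by blast
    have "(L * S ^\<^sub>m k) *\<^sub>v x = 0\<^sub>v 1" if "k < n" for k
    proof (rule eq_vecI)
      fix i assume "i < dim_vec (0\<^sub>v 1 :: real vec)"
      then have i: "i = 0" by simp
      have "((L * S ^\<^sub>m k) *\<^sub>v x) $ 0 = (O' *\<^sub>v x) $ k"
        using that L S x(1) by (auto simp: O'_def scalar_prod_def markov_def)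
      then show "((L * S ^\<^sub>m k) *\<^sub>v x) $ i = 0\<^sub>v 1 $ i"
        using x(3) that i by simp
    qed (use L in auto)
    then have "x = 0\<^sub>v n"
      using obs x(1) S unfolding observable_def by auto
    with x(2) show False by contradiction
  qed
  then have det: "det (transpose_mat O') \<noteq> 0"
    using det_transpose[OF O'] by simp
  have "r = 0"
  proof (rule ccontr)
    assume "r \<noteq> 0"
    then have dr: "degree r < n"
      unfolding r_def using deg by (metis degree_mod_less')
    define v where "v = vec n (coeff r)"
    have v_carrier: "v \<in> carrier_vec n" by (simp add: v_def)
    have "v \<noteq> 0\<^sub>v n"
    proof
      assume "v = 0\<^sub>v n"
      then have "coeff r (degree r) = 0"
        using dr unfolding v_def by (metis index_vec index_zero_vec(1))
      with \<open>r \<noteq> 0\<close> show False by simp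
    qed
    moreover have "transpose_mat O' *\<^sub>v v = 0\<^sub>v n"
    proof (rule eq_vecI)
      fix j assume "j < dim_vec (0\<^sub>v n :: real vec)"
      then have j: "j < n" by simp
      have "(transpose_mat O' *\<^sub>v v) $ j = (\<Sum>k<n. coeff r k * markov L S j k)"
        using j by (auto simp: O'_def v_def scalar_prod_def lessThan_atLeast0 intro!: sum.cong)
      also have "\<dots> = (\<Sum>k\<le>degree r. coeff r k * markov L S j k)"
        using dr by (intro sum.mono_neutral_right) (auto simp: coeff_eq_0)
      also have "\<dots> = seq_eval (markov L S j) (p - char_poly S * (p div char_poly S))"
        unfolding r_def minus_mult_div_eq_mod seq_eval_def ..
      also have "\<dots> = 0"
        using 0 j cayley_hamilton_markov[OF L S j] by (simp add: seq_eval_diff)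
      finally show "(transpose_mat O' *\<^sub>v v) $ j = 0\<^sub>v n $ j" using j by simp
    qed (use O' in auto)
    ultimately have "det (transpose_mat O') = 0"
      using det_0_iff_vec_prod_zero_field[of "transpose_mat O'" n] O'
      by (metis transpose_carrier_mat v_carrier)
    with det show False by contradiction
  qed
  then show "char_poly S dvd p"
    by (simp add: r_def dvd_eq_mod_eq_0)
qed

section \<open>Coprimality and the spectrum\<close>

interpretation of_real_poly_hom: map_poly_inj_idom_hom complex_of_real ..

lemma coprime_if_no_common_root:
  fixes p q :: "complex poly"
  assumes "p \<noteq> 0" and "\<And>z. poly p z = 0 \<Longrightarrow> poly q z \<noteq> 0"
  shows "coprime p q"
proof (rule coprimeI)
  fix d assume d: "d dvd p" "d dvd q"
  then have "poly d z \<noteq> 0" for z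
    using assms(2)[of z] by (metis dvd_trans poly_eq_0_iff_dvd)
  then have "constant (poly d)"
    using fundamental_theorem_of_algebra by blast
  then have "degree d = 0"
    by (simp add: constant_degree)
  with d(1) assms(1) show "is_unit d"
    by (metis dvd_0_left is_unit_iff_degree)
qed

lemma coprime_if_no_common_complex_root:
  fixes p q :: "real poly"
  assumes "p \<noteq> 0"
    and "\<And>z. poly (map_poly complex_of_real p) z = 0 \<Longrightarrow> poly (map_poly complex_of_real q) z \<noteq> 0"
  shows "coprime p q"
proof (rule coprimeI)
  fix d assume d: "d dvd p" "d dvd q"
  let ?d = "map_poly complex_of_real d"
  have "coprime (map_poly complex_of_real p) (map_poly complex_of_real q)"
    using assms by (intro coprime_if_no_common_root) auto
  moreover have "?d dvd map_poly complex_of_real p" "?d dvd map_poly complex_of_real q"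
    using d by (auto intro: of_real_poly_hom.hom_dvd)
  ultimately have "is_unit ?d" by (rule coprime_common_divisor)
  then have "degree d = 0" "d \<noteq> 0"
    by (auto simp: is_unit_iff_degree)
  then show "is_unit d" by (simp add: is_unit_iff_degree)
qed

lemma cspectrum_eq:
  assumes "S \<in> carrier_mat n n"
  shows "cspectrum S = {z. poly (map_poly complex_of_real (char_poly S)) z = 0}"
  using assms spectrum_root_char_poly[of "map_mat complex_of_real S" n]
  by (simp add: cspectrum_def of_real_hom.char_poly_hom[OF assms])

lemma stable_char_poly_nonzero_at_imaginary:
  assumes "A \<in> carrier_mat n n" "asymptotically_stable A" "\<forall>z\<in>cspectrum S. Re z = 0" "z \<in> cspectrum S"
  shows "poly (map_poly complex_of_real (char_poly A)) z \<noteq> 0"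
  using assms(2-4) by (force simp: asymptotically_stable_def cspectrum_eq[OF assms(1)])

lemma coprime_char_poly_if_stable:
  assumes A: "A \<in> carrier_mat n n" and S: "S \<in> carrier_mat m m"
    and "asymptotically_stable A" "\<forall>z\<in>cspectrum S. Re z = 0"
  shows "coprime (char_poly A) (char_poly S)"
proof -
  have "coprime (char_poly S) (char_poly A)"
    using char_poly_nonzero[OF S] stable_char_poly_nonzero_at_imaginary[OF A assms(3,4)]
    by (intro coprime_if_no_common_complex_root) (auto simp: cspectrum_eq[OF S])
  then show ?thesis by (simp add: coprime_commute)
qed

section \<open>The transfer function and the Sylvester equation\<close>

lemma tf_dim_0: "tf_dim 0 = 0"
proof -
  have "transfer_function (0\<^sub>m 0 0) (0\<^sub>m 0 1) (0\<^sub>m 1 0) 0 = 0"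
    by (simp add: transfer_function_def tf_const_def scalar_prod_def)
  then have "\<exists>A B C D. realization A B C D 0 \<and> dim_row A = 0"
    by (intro exI[of _ "0\<^sub>m 0 0"] exI[of _ "0\<^sub>m 0 1"] exI[of _ "0\<^sub>m 1 0"] exI[of _ 0])
       (auto simp: realization_def)
  then show ?thesis
    unfolding tf_dim_def by (simp add: Least_eq_0)
qed

text \<open>
  The entries of \<open>adj (sI - A) B\<close>, which is \<open>(sI - A)\<^sup>-\<^sup>1 B\<close> cleared of its common
  denominator, the characteristic polynomial.
\<close>

definition resolvent_numerator :: "real mat \<Rightarrow> real mat \<Rightarrow> nat \<Rightarrow> real poly" where
  "resolvent_numerator A B k =
     (\<Sum>j<dim_row A. Polynomial.smult (B $$ (j, 0)) (adj_mat (char_poly_matrix A) $$ (k, j)))"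

definition tf_numerator :: "real mat \<Rightarrow> real mat \<Rightarrow> real mat \<Rightarrow> real poly" where
  "tf_numerator A B C = (\<Sum>k<dim_row A. Polynomial.smult (C $$ (0, k)) (resolvent_numerator A B k))"

text \<open>
  The identity \<open>(sI - A) g = \<chi> B\<close> between vectors of polynomials. Substituting \<open>S\<close> for \<open>s\<close>
  in it is what solves the Sylvester equation below.
\<close>

lemma resolvent_numerator_eq:
  assumes A: "A \<in> carrier_mat n n" and k: "k < n"
  shows "pCons 0 (resolvent_numerator A B k)
       = (\<Sum>l<n. Polynomial.smult (A $$ (k, l)) (resolvent_numerator A B l)) + Polynomial.smult (B $$ (k, 0)) (char_poly A)"
proof -
  define D where "D = char_poly_matrix A"
  define G where "G = adj_mat D"
  have prod: "(\<Sum>l<n. D $$ (k, l) * G $$ (l, j)) = (if k = j then char_poly A else 0)" if "j < n" for j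
    unfolding G_def D_def by (rule char_poly_matrix_times_adj_index[OF A k that])
  have g: "resolvent_numerator A B l = (\<Sum>j<n. Polynomial.smult (B $$ (j, 0)) (G $$ (l, j)))" for l
    using A by (simp add: resolvent_numerator_def G_def D_def)
  have "(\<Sum>l<n. D $$ (k, l) * resolvent_numerator A B l)
      = (\<Sum>j<n. Polynomial.smult (B $$ (j, 0)) (\<Sum>l<n. D $$ (k, l) * G $$ (l, j)))"
    unfolding g sum_distrib_left smult_sum2 by (subst sum.swap) simp
  also have "\<dots> = (\<Sum>j<n. if k = j then Polynomial.smult (B $$ (j, 0)) (char_poly A) else 0)"
    by (intro sum.cong) (auto simp: prod)
  also have "\<dots> = Polynomial.smult (B $$ (k, 0)) (char_poly A)"
    using k by simp
  finally have "(\<Sum>l<n. D $$ (k, l) * resolvent_numerator A B l) = Polynomial.smult (B $$ (k, 0)) (char_poly A)" .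
  moreover have "(\<Sum>l<n. D $$ (k, l) * resolvent_numerator A B l)
      = (\<Sum>l<n. (if k = l then pCons 0 (resolvent_numerator A B l) else 0)
            - Polynomial.smult (A $$ (k, l)) (resolvent_numerator A B l))"
    by (intro sum.cong) (auto simp: D_def char_poly_matrix_index[OF A k] left_diff_distrib)
  moreover have "\<dots> = pCons 0 (resolvent_numerator A B k)
       - (\<Sum>l<n. Polynomial.smult (A $$ (k, l)) (resolvent_numerator A B l))"
    using k by (simp add: sum_subtractf)
  ultimately show ?thesis by (simp add: algebra_simps)
qed

lemma mat_inverse_eqI:
  fixes G :: "'a::field mat"
  assumes G: "G \<in> carrier_mat n n" and H: "H \<in> carrier_mat n n"
    and GH: "G * H = 1\<^sub>m n" and HG: "H * G = 1\<^sub>m n"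
  shows "mat_inverse G = Some H"
proof (cases "mat_inverse G")
  case None
  have "G \<in> Units (ring_mat TYPE('a) n undefined)"
    using assms by (auto simp: Units_def ring_mat_def)
  with mat_inverse(1)[OF G None, of undefined] show ?thesis by blast
next
  case (Some X)
  then have X: "X * G = 1\<^sub>m n" "X \<in> carrier_mat n n"
    using mat_inverse(2)[OF G] by auto
  have "X = X * (G * H)" using X GH by simp
  also have "\<dots> = (X * G) * H" by (rule assoc_mult_mat[OF X(2) G H, symmetric])
  finally show ?thesis using X H Some by simp
qed

lemma transfer_function_eq_Fract:
  assumes A: "A \<in> carrier_mat n n" and B: "B \<in> carrier_mat n 1" and C: "C \<in> carrier_mat 1 n"
  shows "transfer_function A B C 0 = Fract (tf_numerator A B C) (char_poly A)"
proof -
  define D where "D = char_poly_matrix A"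
  define N where "N = adj_mat D"
  let ?f = "to_fract :: real poly \<Rightarrow> tf"
  let ?c = "?f (char_poly A)"
  define G where "G = map_mat ?f D"
  define H where "H = (1 / ?c) \<cdot>\<^sub>m map_mat ?f N"
  have D: "D \<in> carrier_mat n n" using A by (simp add: D_def)
  have N: "N \<in> carrier_mat n n" unfolding N_def by (rule adj_mat(1)[OF D])
  have G: "G \<in> carrier_mat n n" and H: "H \<in> carrier_mat n n"
    using D N by (auto simp: G_def H_def)
  have c: "?c \<noteq> 0" using char_poly_nonzero[OF A] by simp
  have Dij: "D $$ (i, j) = (if i = j then [:0, 1:] else 0) - [:A $$ (i, j):]" if "i < n" "j < n" for i j
    unfolding D_def by (rule char_poly_matrix_index[OF A that])
  have G_eq: "tf_s \<cdot>\<^sub>m 1\<^sub>m (dim_row A) - map_mat tf_const A = G"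
    by (rule eq_matI)
       (use A D in \<open>auto simp: G_def Dij tf_s_def tf_const_def
          to_fract_hom.hom_minus\<close>)
  have one: "(1 / ?c) \<cdot>\<^sub>m map_mat ?f (char_poly A \<cdot>\<^sub>m 1\<^sub>m n) = 1\<^sub>m n"
    by (rule eq_matI) (use c in auto)
  have "G * H = (1 / ?c) \<cdot>\<^sub>m map_mat ?f (D * N)"
    using D N by (simp add: G_def H_def to_fract_hom.mat_hom_mult mult_smult_distrib[of _ n n _ n])
  also have "D * N = char_poly A \<cdot>\<^sub>m 1\<^sub>m n"
    unfolding N_def char_poly_def D_def[symmetric] by (rule adj_mat(2)[OF D])
  finally have GH: "G * H = 1\<^sub>m n" using one by simp
  have "H * G = (1 / ?c) \<cdot>\<^sub>m map_mat ?f (N * D)"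
    using D N by (simp add: G_def H_def to_fract_hom.mat_hom_mult mult_smult_assoc_mat[of _ n n _ n])
  also have "N * D = char_poly A \<cdot>\<^sub>m 1\<^sub>m n"
    unfolding N_def char_poly_def D_def[symmetric] by (rule adj_mat(3)[OF D])
  finally have HG: "H * G = 1\<^sub>m n" using one by simp
  have "transfer_function A B C 0 = (map_mat tf_const C * H * map_mat tf_const B) $$ (0, 0)"
    unfolding transfer_function_def G_eq mat_inverse_eqI[OF G H GH HG] by (simp add: tf_const_def)
  also have "\<dots> = (\<Sum>j<n. (\<Sum>k<n. tf_const (C $$ (0, k)) * H $$ (k, j)) * tf_const (B $$ (j, 0)))"
    using B C H by (simp add: scalar_prod_def lessThan_atLeast0 del: assoc_mult_mat)
  also have "\<dots> = (\<Sum>j<n. \<Sum>k<n. ?f (Polynomial.smult (C $$ (0, k)) (Polynomial.smult (B $$ (j, 0)) (N $$ (k, j)))) / ?c)"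
  proof -
    have const: "?f (Polynomial.smult a p) = tf_const a * ?f p" for a p
      by (simp add: tf_const_def flip: to_fract_hom.hom_mult)
    show ?thesis
      unfolding sum_distrib_right
    proof (intro sum.cong refl)
      fix j k assume "j \<in> {..<n}" "k \<in> {..<n}"
      then have "H $$ (k, j) = 1 / ?c * ?f (N $$ (k, j))" using N by (simp add: H_def)
      then show "tf_const (C $$ (0, k)) * H $$ (k, j) * tf_const (B $$ (j, 0))
          = ?f (Polynomial.smult (C $$ (0, k)) (Polynomial.smult (B $$ (j, 0)) (N $$ (k, j)))) / ?c"
        unfolding const by simp
    qed
  qed
  also have "\<dots> = ?f (tf_numerator A B C) / ?c"
    using A unfolding tf_numerator_def resolvent_numerator_def N_def[symmetric] D_def[symmetric]
    by (subst sum.swap) (simp add: smult_sum2 to_fract_hom.hom_sum sum_divide_distrib)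
  finally show ?thesis by (simp add: Fract_conv_to_fract)
qed

text \<open>
  The polynomial \<open>a\<close> of a Bezout identity acts as the inverse of \<open>p(S)\<close>, so that
  \<open>L p(S) a(S) = L\<close>.
\<close>

lemma seq_eval_markov_bezout:
  assumes L: "L \<in> carrier_mat 1 m" and S: "S \<in> carrier_mat m m" and j: "j < m"
    and ab: "a * p + b * char_poly S = 1"
  shows "seq_eval (markov L S j) (p * a) = L $$ (0, j)"
proof -
  have "p * a = 1 - char_poly S * b" using ab by (simp add: algebra_simps)
  then show ?thesis
    using L S j cayley_hamilton_markov[OF L S j, of b] by (simp add: seq_eval_diff markov_def)
qed

text \<open>
  With \<open>g = adj (sI - A) B\<close>, the matrix whose \<open>k\<close>-th row is \<open>L g\<^sub>k(S) \<chi>\<^sub>A(S)\<^sup>-\<^sup>1\<close> solves the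
  Sylvester equation, because \<open>s g - A g = \<chi>\<^sub>A B\<close>; the inverse is taken by a Bezout
  coefficient. Consequently \<open>C X = L W(S)\<close>, where \<open>W\<close> is the transfer function: it depends
  only on \<open>W\<close> and not on its realization.
\<close>

lemma sylvester_solution_exists:
  assumes A: "A \<in> carrier_mat n n" and B: "B \<in> carrier_mat n 1"
    and S: "S \<in> carrier_mat m m" and L: "L \<in> carrier_mat 1 m"
    and ab: "a * char_poly A + b * char_poly S = 1"
  defines "X \<equiv> mat n m (\<lambda>(k, j). seq_eval (markov L S j) (resolvent_numerator A B k * a))"
  shows "A * X + B * L = X * S"
    and "C \<in> carrier_mat 1 n \<Longrightarrow> j < m \<Longrightarrow> (C * X) $$ (0, j) = seq_eval (markov L S j) (tf_numerator A B C * a)"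
proof -
  note one = seq_eval_markov_bezout[OF L S _ ab]
  show "A * X + B * L = X * S"
  proof (rule eq_matI)
    fix k j assume "k < dim_row (X * S)" "j < dim_col (X * S)"
    then have kj: "k < n" "j < m" using S by (auto simp: X_def)
    let ?g = "resolvent_numerator A B"
    have "(X * S) $$ (k, j) = (\<Sum>i<m. S $$ (i, j) * seq_eval (markov L S i) (?g k * a))"
      using kj S by (auto simp: X_def scalar_prod_def lessThan_atLeast0 mult.commute intro!: sum.cong)
    also have "\<dots> = seq_eval (markov L S j) (pCons 0 (?g k) * a)"
      using seq_eval_markov_shift[OF L S kj(2), of "?g k * a"] by simp
    also have "\<dots> = (\<Sum>l<n. A $$ (k, l) * seq_eval (markov L S j) (?g l * a)) + B $$ (k, 0) * L $$ (0, j)"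
      unfolding resolvent_numerator_eq[OF A kj(1)]
      by (simp add: distrib_right sum_distrib_right seq_eval_add seq_eval_sum seq_eval_smult one[OF kj(2)])
    also have "\<dots> = (A * X + B * L) $$ (k, j)"
      using kj A B L by (auto simp: X_def scalar_prod_def lessThan_atLeast0)
    finally show "(A * X + B * L) $$ (k, j) = (X * S) $$ (k, j)" by simp
  qed (use A B L S in \<open>auto simp: X_def\<close>)
  show "(C * X) $$ (0, j) = seq_eval (markov L S j) (tf_numerator A B C * a)"
    if C: "C \<in> carrier_mat 1 n" and j: "j < m"
    using A C j by (auto simp: X_def tf_numerator_def scalar_prod_def lessThan_atLeast0
        sum_distrib_right seq_eval_sum seq_eval_smult)
qed

text \<open>
  If \<open>A X = X S\<close>, then \<open>p(A) X = X p(S)\<close> for all \<open>p\<close>; both characteristic polynomials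
  therefore annihilate \<open>X\<close>, hence so does their greatest common divisor \<open>1\<close>.
\<close>

lemma sylvester_homogeneous:
  fixes A S :: "real mat"
  assumes A: "A \<in> carrier_mat n n" and S: "S \<in> carrier_mat m m" and X: "X \<in> carrier_mat n m"
    and eq: "A * X = X * S" and cop: "coprime (char_poly A) (char_poly S)"
  shows "X = 0\<^sub>m n m"
proof (rule eq_matI)
  fix k j assume "k < dim_row (0\<^sub>m n m :: real mat)" "j < dim_col (0\<^sub>m n m :: real mat)"
  then have kj: "k < n" "j < m" by auto
  define D where "D = (\<lambda>k j i. (A ^\<^sub>m i * X) $$ (k, j))"
  have pow: "A ^\<^sub>m i \<in> carrier_mat n n" for i using A by simp
  have right: "D k j (Suc i) = (\<Sum>l<m. S $$ (l, j) * D k l i)" if "k < n" "j < m" for k j i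
  proof -
    have "A ^\<^sub>m Suc i * X = (A ^\<^sub>m i * X) * S"
      by (simp only: pow_mat.simps assoc_mult_mat[OF pow A X] eq assoc_mult_mat[OF pow X S])
    then have "D k j (Suc i) = ((A ^\<^sub>m i * X) * S) $$ (k, j)"
      by (simp only: D_def)
    then show ?thesis
      using that S X pow[of i]
      by (auto simp: D_def scalar_prod_def lessThan_atLeast0 mult.commute simp del: assoc_mult_mat intro!: sum.cong)
  qed
  have left: "D k j (Suc i) = (\<Sum>l<n. transpose_mat A $$ (l, k) * D l j i)" if "k < n" "j < m" for k j i
  proof -
    have "A ^\<^sub>m Suc i = A * A ^\<^sub>m i"
      by (induction i) (use A in \<open>auto simp: assoc_mult_mat[OF A pow A]\<close>)
    then have "A ^\<^sub>m Suc i * X = A * (A ^\<^sub>m i * X)"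
      by (simp only: assoc_mult_mat[OF A pow X])
    then have "D k j (Suc i) = (A * (A ^\<^sub>m i * X)) $$ (k, j)"
      by (simp only: D_def)
    then show ?thesis
      using that A X pow[of i]
      by (auto simp: D_def scalar_prod_def lessThan_atLeast0 simp del: assoc_mult_mat intro!: sum.cong)
  qed
  obtain a b where ab: "a * char_poly A + b * char_poly S = 1"
    using cop bezout_coefficients_fst_snd[of "char_poly A" "char_poly S"] by (metis coprime_imp_gcd_eq_1)
  have "seq_eval (D k j) (char_poly (transpose_mat A) * a) = 0"
    by (rule cayley_hamilton_seq[where u="\<lambda>k. D k j" and n=n]) (use A kj left in auto)
  then have "seq_eval (D k j) (a * char_poly A) = 0"
    using A by (simp add: mult.commute)
  moreover have "seq_eval (D k j) (char_poly S * b) = 0"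
    by (rule cayley_hamilton_seq[where u="D k" and n=m]) (use S kj right in auto)
  ultimately have "seq_eval (D k j) 1 = 0"
    by (simp add: ab[symmetric] seq_eval_add mult.commute)
  then show "X $$ (k, j) = 0\<^sub>m n m $$ (k, j)"
    using kj A X by (simp add: D_def)
qed (use X in auto)

lemma sylvester_solution_unique:
  fixes A S B L :: "real mat"
  assumes A: "A \<in> carrier_mat n n" and S: "S \<in> carrier_mat m m"
    and B: "B \<in> carrier_mat n 1" and L: "L \<in> carrier_mat 1 m"
    and X: "X \<in> carrier_mat n m" "A * X + B * L = X * S"
    and Y: "Y \<in> carrier_mat n m" "A * Y + B * L = Y * S"
    and cop: "coprime (char_poly A) (char_poly S)"
  shows "X = Y"
proof -
  have "A * X - A * Y = (A * X + B * L) - (A * Y + B * L)"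
    using A B L X(1) Y(1) by (intro eq_matI) auto
  then have "A * (X - Y) = (X - Y) * S"
    using A S X Y by (simp add: mult_minus_distrib_mat[OF A X(1) Y(1)] minus_mult_distrib_mat[OF X(1) Y(1) S])
  then have "X - Y = 0\<^sub>m n m"
    using X(1) Y(1) by (intro sylvester_homogeneous[OF A S _ _ cop]) auto
  then have "X $$ (i, j) = Y $$ (i, j)" if "i < n" "j < m" for i j
    using that X Y by (metis carrier_matD eq_iff_diff_eq_0 index_minus_mat(1) index_zero_mat(1))
  then show ?thesis using X Y by (intro eq_matI) auto
qed

text \<open>
  Write \<open>W = n / \<chi>\<^sub>A\<close>. Since \<open>C X = L n(S) \<chi>\<^sub>A(S)\<^sup>-\<^sup>1\<close>, the equation \<open>C X = L\<close> says
  \<open>L (\<chi>\<^sub>A - n)(S) = 0\<close>, which by observability means that \<open>\<chi>\<^sub>S\<close> divides \<open>\<chi>\<^sub>A - n\<close>, the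
  numerator of \<open>1 - W\<close>.
\<close>

lemma sylvester_moments_eq_iff_dvd:
  assumes A: "A \<in> carrier_mat n n" and B: "B \<in> carrier_mat n 1" and C: "C \<in> carrier_mat 1 n"
    and S: "S \<in> carrier_mat m m" and L: "L \<in> carrier_mat 1 m" and obs: "observable L S"
    and cop: "coprime (char_poly A) (char_poly S)"
  shows "\<exists>X. X \<in> carrier_mat n m \<and> A * X + B * L = X * S \<and> sylvester_solution A B S L = X
      \<and> (C * X = L \<longleftrightarrow> char_poly S dvd char_poly A - tf_numerator A B C)"
proof -
  obtain a b where ab: "a * char_poly A + b * char_poly S = 1"
    using cop bezout_coefficients_fst_snd[of "char_poly A" "char_poly S"] by (metis coprime_imp_gcd_eq_1)
  define X where "X = mat n m (\<lambda>(k, j). seq_eval (markov L S j) (resolvent_numerator A B k * a))"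
  note syl = sylvester_solution_exists[OF A B S L ab, folded X_def]
  have X: "X \<in> carrier_mat n m" by (simp add: X_def)
  have "sylvester_solution A B S L = X"
    unfolding sylvester_solution_def
    by (rule the_equality)
       (use A S X syl(1) in \<open>auto intro: sylvester_solution_unique[OF A S B L _ _ X syl(1) cop]\<close>)
  moreover have "C * X = L \<longleftrightarrow> char_poly S dvd char_poly A - tf_numerator A B C"
  proof -
    note Lj = seq_eval_markov_bezout[OF L S _ ab, symmetric]
    have "C * X = L \<longleftrightarrow> (\<forall>j<m. (C * X) $$ (0, j) = L $$ (0, j))"
      using C X L by (auto intro!: eq_matI)
    also have "\<dots> \<longleftrightarrow> (\<forall>j<m. seq_eval (markov L S j) ((char_poly A - tf_numerator A B C) * a) = 0)"
      using syl(2)[OF C] Lj by (auto simp: left_diff_distrib seq_eval_diff)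
    also have "\<dots> \<longleftrightarrow> char_poly S dvd (char_poly A - tf_numerator A B C) * a"
      by (rule seq_eval_markov_0_iff_dvd[OF L S obs])
    also have "\<dots> \<longleftrightarrow> char_poly S dvd char_poly A - tf_numerator A B C"
    proof (rule coprime_dvd_mult_left_iff)
      show "coprime (char_poly S) a"
      proof (rule coprimeI)
        fix d assume "d dvd char_poly S" "d dvd a"
        then have "d dvd a * char_poly A + b * char_poly S" by simp
        then show "is_unit d" by (simp add: ab)
      qed
    qed
    finally show ?thesis .
  qed
  ultimately show ?thesis using X syl(1) by blast
qed

section \<open>Vanishing moments as divisibility\<close>

lemma tf_eval_Fract:
  assumes "poly (map_poly complex_of_real q) z \<noteq> 0"
  shows "tf_eval (Fract p q) z = poly (map_poly complex_of_real p) z / poly (map_poly complex_of_real q) z"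
  unfolding tf_eval_def
proof (rule the_equality)
  fix w assume "\<exists>p' q'. Fract p q = Fract p' q' \<and> poly (map_poly complex_of_real q') z \<noteq> 0 \<and>
      w = poly (map_poly complex_of_real p') z / poly (map_poly complex_of_real q') z"
  then obtain p' q' where *: "Fract p q = Fract p' q'" "poly (map_poly complex_of_real q') z \<noteq> 0"
      "w = poly (map_poly complex_of_real p') z / poly (map_poly complex_of_real q') z"
    by blast
  have "q \<noteq> 0" "q' \<noteq> 0" using assms *(2) by auto
  with *(1) have "p * q' = p' * q" by (simp add: eq_fract)
  then have "map_poly complex_of_real (p * q') = map_poly complex_of_real (p' * q)" by simp
  then have "poly (map_poly complex_of_real p) z * poly (map_poly complex_of_real q') z
      = poly (map_poly complex_of_real p') z * poly (map_poly complex_of_real q) z"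
    by (metis of_real_poly_hom.hom_mult poly_mult)
  then show "w = poly (map_poly complex_of_real p) z / poly (map_poly complex_of_real q) z"
    unfolding *(3) frac_eq_eq[OF *(2) assms] by (rule sym)
qed (use assms in blast)

lemma higher_deriv_poly: "(deriv ^^ k) (poly p) = poly ((pderiv ^^ k) (p :: complex poly))"
proof (induction k)
  case (Suc k)
  have "deriv (poly r) = poly (pderiv r)" for r :: "complex poly"
    by (rule ext) (rule DERIV_imp_deriv[OF poly_DERIV])
  with Suc show ?case by simp
qed simp

lemma linear_power_dvd_iff_pderivs_vanish:
  fixes p :: "complex poly"
  shows "[:- z, 1:] ^ m dvd p \<longleftrightarrow> (\<forall>k<m. poly ((pderiv ^^ k) p) z = 0)"
proof (induction m arbitrary: p)
  case (Suc m)
  show ?case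
  proof (cases "poly p z = 0")
    case True
    have "[:- z, 1:] ^ Suc m dvd p \<longleftrightarrow> [:- z, 1:] ^ m dvd pderiv p"
    proof (cases "p = 0")
      case False
      show ?thesis
      proof (cases "pderiv p = 0")
        case True
        with \<open>poly p z = 0\<close> False show ?thesis
          by (auto simp: pderiv_eq_0_iff elim!: degree_eq_zeroE)
      next
        case 2: False
        then show ?thesis
          using order_pderiv[OF False True] False
          unfolding order_divides by simp
      qed
    qed simp
    also have "\<dots> \<longleftrightarrow> (\<forall>k<m. poly ((pderiv ^^ Suc k) p) z = 0)"
      by (simp only: Suc funpow_Suc_right o_apply)
    also have "\<dots> \<longleftrightarrow> (\<forall>k<Suc m. poly ((pderiv ^^ k) p) z = 0)"
      using True by (auto simp: less_Suc_eq_0_disj)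
    finally show ?thesis .
  next
    case False
    then have "\<not> [:- z, 1:] ^ Suc m dvd p"
      by (metis dvd_mult_left poly_eq_0_iff_dvd power_Suc)
    with False show ?thesis by (auto intro!: exI[of _ 0])
  qed
qed simp

lemma higher_derivs_mult_vanish:
  fixes f g :: "complex \<Rightarrow> complex"
  assumes "f holomorphic_on U" "g holomorphic_on U" "open U" "z \<in> U"
    and "\<forall>k<m. (deriv ^^ k) f z = 0" and "k < m"
  shows "(deriv ^^ k) (\<lambda>w. f w * g w) z = 0"
  unfolding higher_deriv_mult[OF assms(1-4)]
  using assms(5,6) by (intro sum.neutral) auto

text \<open>
  The moments at \<open>z\<close> are Taylor coefficients up to nonzero factors, so the first \<open>m\<close> of
  them vanish iff the function has a zero of order at least \<open>m\<close>. By the Leibniz rule this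
  property survives multiplication by a holomorphic function; applied to the
  denominator and to its inverse, this reduces the claim to the numerator.
\<close>

lemma moments_vanish_iff_dvd:
  assumes q: "poly (map_poly complex_of_real q) z \<noteq> 0"
  shows "(\<forall>k<m. moment k (Fract p q) z = 0) \<longleftrightarrow> [:- z, 1:] ^ m dvd map_poly complex_of_real p"
proof -
  let ?p = "map_poly complex_of_real p" and ?q = "map_poly complex_of_real q"
  define U where "U = {w. poly ?q w \<noteq> 0}"
  define f where "f = tf_eval (Fract p q)"
  have U: "open U" "z \<in> U"
    unfolding U_def using q by (auto intro!: open_Collect_neq continuous_intros)
  have f: "f w = poly ?p w / poly ?q w" if "w \<in> U" for w
    using that by (simp add: f_def U_def tf_eval_Fract)
  have hol_poly: "poly r holomorphic_on U" for r :: "complex poly"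
    unfolding holomorphic_on_def field_differentiable_def
    using has_field_derivative_at_within[OF poly_DERIV] by fast
  have hol_inv: "(\<lambda>w. inverse (poly ?q w)) holomorphic_on U"
    by (rule holomorphic_on_inverse[OF hol_poly]) (simp add: U_def)
  have hol_quot: "(\<lambda>w. poly ?p w * inverse (poly ?q w)) holomorphic_on U"
    by (intro holomorphic_on_mult hol_poly hol_inv)
  have hol_f: "f holomorphic_on U"
    using hol_quot by (rule holomorphic_transform) (simp add: f divide_inverse)
  have f_eq: "(deriv ^^ k) f z = (deriv ^^ k) (\<lambda>w. poly ?p w * inverse (poly ?q w)) z" for k
    by (rule higher_deriv_transform_within_open[OF hol_f hol_quot U]) (simp add: f divide_inverse)
  have p_eq: "(deriv ^^ k) (poly ?p) z = (deriv ^^ k) (\<lambda>w. f w * poly ?q w) z" for k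
    by (rule higher_deriv_transform_within_open[OF hol_poly holomorphic_on_mult[OF hol_f hol_poly] U])
       (simp add: f U_def)
  have "(\<forall>k<m. moment k (Fract p q) z = 0) \<longleftrightarrow> (\<forall>k<m. (deriv ^^ k) f z = 0)"
    by (simp add: moment_def f_def)
  also have "\<dots> \<longleftrightarrow> (\<forall>k<m. (deriv ^^ k) (poly ?p) z = 0)"
    using higher_derivs_mult_vanish[OF hol_f hol_poly U, of m _ ?q]
      higher_derivs_mult_vanish[OF hol_poly hol_inv U, of m ?p]
    unfolding p_eq[symmetric] f_eq[symmetric] by blast
  also have "\<dots> \<longleftrightarrow> [:- z, 1:] ^ m dvd ?p"
    by (simp only: higher_deriv_poly linear_power_dvd_iff_pderivs_vanish)
  finally show ?thesis .
qed

text \<open>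
  Powers of distinct linear factors are coprime, and over the complex numbers their product is
  the whole polynomial up to a unit.
\<close>

lemma complex_poly_dvd_if_root_powers_dvd:
  fixes p q :: "complex poly"
  assumes "p \<noteq> 0" and "\<And>z. poly p z = 0 \<Longrightarrow> [:- z, 1:] ^ order z p dvd q"
  shows "p dvd q"
  using assms
proof (induction p rule: poly_root_order_induct)
  case (no_roots p)
  then have "constant (poly p)"
    using fundamental_theorem_of_algebra by blast
  with no_roots.prems(1) have "is_unit p"
    by (simp add: is_unit_iff_degree constant_degree)
  then show ?case by (rule unit_imp_dvd)
next
  case (root p x n)
  then have "p \<noteq> 0" and l: "[:- x, 1:] ^ n \<noteq> 0" by auto
  have "order x p = 0" using root.hyps by (simp add: order_0I)
  then have "order x ([:- x, 1:] ^ n * p) = n"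
    using root.prems(1) order_power_n_n[of x n] by (simp add: order_mult)
  then have x: "[:- x, 1:] ^ n dvd q"
    using root.prems(2)[of x] root.hyps by auto
  have "p dvd q"
  proof (rule root.IH[OF \<open>p \<noteq> 0\<close>])
    fix z assume z: "poly p z = 0"
    with root.hyps have "z \<noteq> x" by auto
    then have "order z ([:- x, 1:] ^ n) = 0" by (intro order_0I) auto
    then have "order z ([:- x, 1:] ^ n * p) = order z p"
      using root.prems(1) by (simp add: order_mult)
    then show "[:- z, 1:] ^ order z p dvd q"
      using root.prems(2)[of z] z by auto
  qed
  moreover have "coprime ([:- x, 1:] ^ n) p"
    using l root.hyps by (intro coprime_if_no_common_root) auto
  ultimately show ?case
    using x by (intro divides_mult)
qed auto

text \<open>
  The orders of the prescribed zeros are the multiplicities of the roots of \<open>\<chi>\<^sub>S\<close>, so over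
  the complex numbers the conditions at all eigenvalues combine to divisibility by \<open>\<chi>\<^sub>S\<close>.
\<close>

lemma moments_vanish_at_spectrum_iff_dvd:
  assumes S: "S \<in> carrier_mat n n"
    and q: "\<And>z. z \<in> cspectrum S \<Longrightarrow> poly (map_poly complex_of_real q) z \<noteq> 0"
  shows "moments_vanish_at_spectrum (Fract p q) S \<longleftrightarrow> char_poly S dvd p"
proof -
  let ?c = "map_poly complex_of_real (char_poly S)" and ?p = "map_poly complex_of_real p"
  have c: "?c \<noteq> 0" using char_poly_nonzero[OF S] by simp
  have "moments_vanish_at_spectrum (Fract p q) S
      \<longleftrightarrow> (\<forall>z\<in>cspectrum S. \<forall>k<order z ?c. moment k (Fract p q) z = 0)"
    by (simp add: moments_vanish_at_spectrum_def alg_multiplicity_def of_real_hom.char_poly_hom[OF S])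
  also have "\<dots> \<longleftrightarrow> (\<forall>z\<in>cspectrum S. [:- z, 1:] ^ order z ?c dvd ?p)"
    using moments_vanish_iff_dvd[OF q] by simp
  also have "\<dots> \<longleftrightarrow> ?c dvd ?p"
  proof
    assume "?c dvd ?p"
    then show "\<forall>z\<in>cspectrum S. [:- z, 1:] ^ order z ?c dvd ?p"
      using order_1 dvd_trans by blast
  qed (auto intro: complex_poly_dvd_if_root_powers_dvd[OF c] simp: cspectrum_eq[OF S])
  also have "\<dots> \<longleftrightarrow> char_poly S dvd p"
    using of_real_hom.dvd_map_poly_hom_imp_dvd of_real_poly_hom.hom_dvd by blast
  finally show ?thesis .
qed

section \<open>Decay of solutions of scalar differential equations\<close>

text \<open>
  A stable first-order filter turns a vanishing input into a vanishing output. With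
  \<open>a = - Re z\<close>, the function \<open>exp (-z t) g t\<close> has derivative \<open>exp (-z t) h t\<close>, so after a time
  when \<open>\<bar>h\<bar> < d\<close> it grows by at most \<open>d / a * exp (a t)\<close>, which contributes at most \<open>d / a\<close>
  to \<open>\<bar>g t\<bar>\<close>.
\<close>

lemma filtered_tendsto_zero:
  fixes g h :: "real \<Rightarrow> complex"
  assumes ode: "\<And>t. t \<ge> 0 \<Longrightarrow> (g has_vector_derivative (z * g t + h t)) (at t within {0..})"
    and z: "Re z < 0" and h: "(h \<longlongrightarrow> 0) at_top"
  shows "(g \<longlongrightarrow> 0) at_top"
proof (rule tendstoI)
  fix e :: real assume e: "e > 0"
  define a where "a = - Re z"
  have a: "a > 0" using z by (simp add: a_def)
  define d where "d = a * e / 2"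
  have d: "d > 0" using a e by (simp add: d_def)
  obtain T0 where T0: "\<And>t. t \<ge> T0 \<Longrightarrow> norm (h t) < d"
    using tendstoD[OF h d] by (auto simp: eventually_at_top_linorder)
  define T where "T = max T0 0"
  have T: "T \<ge> 0" "\<And>t. t \<ge> T \<Longrightarrow> norm (h t) < d"
    using T0 by (auto simp: T_def)
  define u where "u = (\<lambda>t. exp (- z * of_real t) * g t)"
  have expd: "((\<lambda>t. exp (- z * of_real t)) has_vector_derivative (- z * exp (- z * of_real t))) (at t within X)" for t X
    by (rule has_vector_derivative_real_field)
       (auto intro!: derivative_eq_intros)
  have u: "(u has_vector_derivative (exp (- z * of_real t) * h t)) (at t within {0..})" if "t \<ge> 0" for t
    unfolding u_def
    by (rule has_vector_derivative_eq_rhs[OF has_vector_derivative_mult[OF expd ode[OF that]]])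
       (simp add: algebra_simps)
  have bound: "norm (u t - u T) \<le> d / a * exp (a * t)" if t: "t > T" for t
  proof -
    have "norm (u t - u T) \<le> d / a * exp (a * t) - d / a * exp (a * T)"
    proof (rule differentiable_bound_general[OF t])
      show "continuous_on {T..t} u"
        unfolding continuous_on_eq_continuous_within
      proof
        fix s assume "s \<in> {T..t}"
        then have "continuous (at s within {0..}) u"
          using u[of s] T(1) by (auto intro: has_vector_derivative_continuous)
        then show "continuous (at s within {T..t}) u"
          by (rule continuous_within_subset) (use T(1) in auto)
      qed
      show "continuous_on {T..t} (\<lambda>t. d / a * exp (a * t))"
        by (intro continuous_intros)
      show "(u has_vector_derivative (exp (- z * of_real s) * h s)) (at s)" if "T < s" "s < t" for s
      proof -
        have "s > 0" using that T(1) by linarith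
        then have "at s within {0..} = at s"
          by (intro at_within_interior) simp
        with u[of s] \<open>s > 0\<close> show ?thesis by simp
      qed
      show "((\<lambda>t. d / a * exp (a * t)) has_vector_derivative (d * exp (a * s))) (at s)" for s
        using a by (auto intro!: derivative_eq_intros simp: has_real_derivative_iff_has_vector_derivative[symmetric])
      show "norm (exp (- z * of_real s) * h s) \<le> d * exp (a * s)" if "T < s" for s
      proof -
        have "norm (exp (- z * of_real s) * h s) = exp (a * s) * norm (h s)"
          by (simp add: norm_mult a_def)
        also have "\<dots> \<le> exp (a * s) * d"
          using T(2)[of s] that by (intro mult_left_mono) auto
        finally show ?thesis by (simp add: mult.commute)
      qed
    qed
    also have "\<dots> \<le> d / a * exp (a * t)" using d a by simp
    finally show ?thesis .
  qed
  have g: "norm (g t) \<le> exp (- a * t) * norm (u T) + e / 2" if t: "t > T" for t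
  proof -
    have "g t = exp (z * of_real t) * u t"
      by (simp add: u_def mult.assoc[symmetric] exp_add[symmetric])
    then have "norm (g t) = exp (- a * t) * norm (u t)"
      by (simp add: norm_mult a_def)
    also have "norm (u t) \<le> norm (u T) + d / a * exp (a * t)"
      using bound[OF t] norm_triangle_ineq[of "u t - u T" "u T"] by simp
    also have "exp (- a * t) * (norm (u T) + d / a * exp (a * t)) = exp (- a * t) * norm (u T) + d / a * (exp (- a * t) * exp (a * t))"
      by (simp add: algebra_simps)
    also have "d / a * (exp (- a * t) * exp (a * t)) = e / 2"
      using a by (simp add: exp_add[symmetric] d_def)
    finally show ?thesis by simp
  qed
  have "((\<lambda>t. exp (- a * t) * norm (u T)) \<longlongrightarrow> 0) at_top"
  proof (rule tendsto_mult_left_zero)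
    have "filterlim (\<lambda>t. - a * t) at_bot at_top"
      using a by (intro filterlim_tendsto_neg_mult_at_bot[OF tendsto_const _ filterlim_ident]) auto
    then show "((\<lambda>t. exp (- a * t)) \<longlongrightarrow> 0) at_top"
      by (rule filterlim_compose[OF exp_at_bot])
  qed
  then have "eventually (\<lambda>t. dist (exp (- a * t) * norm (u T)) 0 < e / 2) at_top"
    by (rule tendstoD) (use e in simp)
  then show "eventually (\<lambda>t. dist (g t) 0 < e) at_top"
    using eventually_gt_at_top[of T]
  proof eventually_elim
    case (elim t)
    have "exp (- a * t) * norm (u T) < e / 2"
      using elim(1) by (simp add: dist_norm)
    with g[OF elim(2)] show ?case by (simp add: dist_norm)
  qed
qed

lemma unimodular_mode_eq_0:
  fixes g :: "real \<Rightarrow> complex"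
  assumes ode: "\<And>t. t \<ge> 0 \<Longrightarrow> (g has_vector_derivative (z * g t)) (at t within {0..})"
    and z: "Re z = 0" and g: "(g \<longlongrightarrow> 0) at_top" and t: "t \<ge> 0"
  shows "g t = 0"
proof -
  define u where "u = (\<lambda>t. exp (- z * of_real t) * g t)"
  have expd: "((\<lambda>t. exp (- z * of_real t)) has_vector_derivative (- z * exp (- z * of_real t))) (at t within X)" for t X
    by (rule has_vector_derivative_real_field) (auto intro!: derivative_eq_intros)
  have "(u has_vector_derivative 0) (at t within {0..})" if "t \<in> {0..}" for t
    unfolding u_def
    by (rule has_vector_derivative_eq_rhs[OF has_vector_derivative_mult[OF expd ode]])
       (use that in auto)
  then obtain c where c: "\<And>t. t \<in> {0..} \<Longrightarrow> u t = c"
    using has_vector_derivative_zero_constant[of "{0..}" u] by (metis convex_real_interval(1))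
  have norm_g: "norm (g t) = norm c" if "t \<ge> 0" for t
    using c[of t] that z by (simp add: u_def norm_mult flip: c[of t])
  have "eventually (\<lambda>t. norm (g t) = norm c) at_top"
    using eventually_ge_at_top[of 0] by eventually_elim (rule norm_g)
  moreover have "((\<lambda>t. norm (g t)) \<longlongrightarrow> 0) at_top"
    using g by (rule tendsto_norm_zero)
  ultimately have "((\<lambda>t. norm c) \<longlongrightarrow> 0) (at_top :: real filter)"
    using filterlim_cong by fastforce
  then have "norm c = 0"
    using tendsto_const_iff trivial_limit_at_top_linorder by blast
  then show ?thesis using norm_g[OF t] by simp
qed

text \<open>
  A signal together with all its derivatives on the half-line \<open>t \<ge> 0\<close>. Applying
  \<^const>\<open>seq_eval\<close> at time \<open>t\<close> to a polynomial \<open>p\<close> then yields \<open>p(d/dt)\<close> of the signal, and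
  multiplying \<open>p\<close> by \<open>s\<close> amounts to differentiating in \<open>t\<close>.
\<close>

definition jet :: "(nat \<Rightarrow> real \<Rightarrow> complex) \<Rightarrow> bool" where
  "jet y \<longleftrightarrow> (\<forall>k. \<forall>t\<ge>0. (y k has_vector_derivative y (Suc k) t) (at t within {0..}))"

lemma jet_seq_eval_derivative:
  assumes "jet y" "t \<ge> 0"
  shows "((\<lambda>t. seq_eval (\<lambda>k. y k t) p) has_vector_derivative seq_eval (\<lambda>k. y k t) (pCons 0 p))
           (at t within {0..})"
  unfolding seq_eval_shift unfolding seq_eval_def using assms
  by (intro has_vector_derivative_sum has_vector_derivative_mult_right) (auto simp: jet_def)

lemma jet_seq_eval_linear_factor:
  assumes "jet y" "t \<ge> 0"
  shows "((\<lambda>t. seq_eval (\<lambda>k. y k t) p) has_vector_derivative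
           (z * seq_eval (\<lambda>k. y k t) p + seq_eval (\<lambda>k. y k t) ([:- z, 1:] * p))) (at t within {0..})"
proof -
  have "pCons 0 p = Polynomial.smult z p + [:- z, 1:] * p" by simp
  then show ?thesis
    using jet_seq_eval_derivative[OF assms, of p] by (simp only: seq_eval_add seq_eval_smult)
qed

text \<open>
  Removing a factor \<open>s - z\<close> means passing the signal through a stable first-order
  filter, which preserves convergence to zero.
\<close>

lemma jet_cancel_stable_factors:
  assumes y: "jet y" and zs: "\<forall>z\<in>set zs. Re z < 0"
    and lim: "((\<lambda>t. seq_eval (\<lambda>k. y k t) ((\<Prod>z\<leftarrow>zs. [:- z, 1:]) * p)) \<longlongrightarrow> 0) at_top"
  shows "((\<lambda>t. seq_eval (\<lambda>k. y k t) p) \<longlongrightarrow> 0) at_top"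
  using zs lim
proof (induction zs)
  case (Cons z zs)
  have "((\<lambda>t. seq_eval (\<lambda>k. y k t) ((\<Prod>z\<leftarrow>zs. [:- z, 1:]) * p)) \<longlongrightarrow> 0) at_top"
    by (rule filtered_tendsto_zero[OF jet_seq_eval_linear_factor[OF y, of _ _ z]])
       (use Cons.prems in \<open>simp_all add: mult.assoc del: mult_pCons_left\<close>)
  with Cons.IH Cons.prems(1) show ?case by simp
qed simp

text \<open>
  Once the factors in front of it are gone, a purely imaginary factor \<open>s - z\<close> leaves a
  signal of the form \<open>c exp (z t)\<close> with constant modulus, which can converge to zero only if
  \<open>c = 0\<close>.
\<close>

lemma jet_cancel_imaginary_factors:
  assumes y: "jet y" and zs: "\<forall>z\<in>set zs. Re z = 0"
    and lim: "\<And>p. ((\<lambda>t. seq_eval (\<lambda>k. y k t) p) \<longlongrightarrow> 0) at_top"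
    and ann: "\<And>t. t \<ge> 0 \<Longrightarrow> seq_eval (\<lambda>k. y k t) ((\<Prod>z\<leftarrow>zs. [:- z, 1:]) * p) = 0"
    and t: "t \<ge> 0"
  shows "seq_eval (\<lambda>k. y k t) p = 0"
  using zs ann t
proof (induction zs arbitrary: t)
  case (Cons z zs)
  have "seq_eval (\<lambda>k. y k t) ((\<Prod>z\<leftarrow>zs. [:- z, 1:]) * p) = 0" if "t \<ge> 0" for t
  proof (rule unimodular_mode_eq_0[OF _ _ lim that])
    show "((\<lambda>t. seq_eval (\<lambda>k. y k t) ((\<Prod>z\<leftarrow>zs. [:- z, 1:]) * p)) has_vector_derivative
             z * seq_eval (\<lambda>k. y k t) ((\<Prod>z\<leftarrow>zs. [:- z, 1:]) * p)) (at t within {0..})" if "t \<ge> 0" for t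
      using jet_seq_eval_linear_factor[OF y that, of "(\<Prod>z\<leftarrow>zs. [:- z, 1:]) * p" z] Cons.prems(2)[OF that]
      by (simp add: mult.assoc del: mult_pCons_left)
  qed (use Cons.prems in simp)
  with Cons show ?case by simp
qed simp

text \<open>
  For a signal that solves \<open>q(d/dt) y = 0\<close>, convergence of the signal to zero forces
  convergence of all its derivatives, although \<open>q\<close> need not be stable. The trick is to produce
  derivatives by filtering: \<open>s + 1\<close> is invertible modulo \<open>q\<close>, so the signal is
  \<open>(d/dt + 1)\<^sup>n u\<close> for \<open>u = a(d/dt) y\<close>. Removing stable factors \<open>s + 1\<close> one at a time, all
  \<open>(d/dt + 1)\<^sup>k u\<close> with \<open>k \<le> n\<close> vanish at infinity, and modulo \<open>q\<close> they span all
  derivatives of \<open>y\<close> because \<open>n\<close> is the degree of \<open>q\<close>.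
\<close>

lemma jet_tendsto_zero_all:
  assumes y: "jet y" and q: "poly q (-1) \<noteq> 0"
    and ann: "\<And>p t. t \<ge> 0 \<Longrightarrow> seq_eval (\<lambda>k. y k t) (q * p) = 0"
    and lim: "(y 0 \<longlongrightarrow> 0) at_top"
  shows "((\<lambda>t. seq_eval (\<lambda>k. y k t) p) \<longlongrightarrow> 0) at_top"
proof -
  define \<Lambda> where "\<Lambda> = (\<lambda>p t. seq_eval (\<lambda>k. y k t) p)"
  define n where "n = degree q"
  define s where "s = [:1, 1 :: complex:]"
  have "coprime s q"
    using q by (intro coprime_if_no_common_root) (auto simp: s_def add_eq_0_iff)
  then have "coprime (s ^ n) q" by (metis coprime_power_left_iff)
  then obtain a b where ab: "a * s ^ n + b * q = 1"
    using bezout_coefficients_fst_snd[of "s ^ n" q] by (metis coprime_imp_gcd_eq_1)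
  have mod: "\<Lambda> (r + q * w) t = \<Lambda> r t" if "t \<ge> 0" for r w t
    using ann[OF that] by (simp add: \<Lambda>_def seq_eval_add)
  \<comment> \<open>\<open>s ^ (n - k) * h\<close> with \<open>degree h \<le> k\<close> runs through the span of \<open>s ^ (n - k), \<dots>, s ^ n\<close>:
      each induction step admits one more removed factor.\<close>
  have *: "(\<Lambda> (s ^ (n - k) * h * a) \<longlongrightarrow> 0) at_top" if "k \<le> n" "degree h \<le> k" for k h
    using that
  proof (induction k arbitrary: h)
    case 0
    then obtain c where h: "h = [:c:]" by (auto elim: degree_eq_zeroE)
    have "s ^ n * h * a + q * (Polynomial.smult c b) = Polynomial.smult c (a * s ^ n + b * q)"
      by (simp add: h algebra_simps smult_add_right)
    then have eq: "s ^ n * h * a + q * (Polynomial.smult c b) = Polynomial.smult c 1"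
      by (simp only: ab)
    have "\<Lambda> (s ^ n * h * a) t = c * y 0 t" if "t \<ge> 0" for t
      using mod[OF that, of "s ^ n * h * a" "Polynomial.smult c b"]
      by (simp only: eq \<Lambda>_def seq_eval_smult seq_eval_1)
    then have "eventually (\<lambda>t. c * y 0 t = \<Lambda> (s ^ n * h * a) t) at_top"
      using eventually_mono[OF eventually_ge_at_top[of 0]] by (metis (mono_tags, lifting))
    moreover have "((\<lambda>t. c * y 0 t) \<longlongrightarrow> 0) at_top"
      using lim by (rule tendsto_mult_right_zero)
    ultimately show ?case by (auto intro: Lim_transform_eventually)
  next
    case (Suc k)
    define u where "u = synthetic_div h (-1)"
    define c where "c = poly h (-1)"
    have h: "h = s * u + [:c:]"
      using synthetic_div_correct'[of "-1" h] by (simp add: s_def u_def c_def)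
    have u: "degree u \<le> k" using Suc.prems by (simp add: u_def degree_synthetic_div)
    have nk: "n - k = Suc (n - Suc k)" using Suc.prems by simp
    have "(\<Lambda> (s ^ (n - k) * u * a) \<longlongrightarrow> 0) at_top"
      using Suc u by simp
    moreover have "(\<Lambda> (s ^ (n - Suc k) * [:c:] * a) \<longlongrightarrow> 0) at_top"
      unfolding \<Lambda>_def
    proof (rule jet_cancel_stable_factors[OF y, of "[-1]"])
      have "s ^ (n - k) * [:c:] * a = [:1, 1:] * (s ^ (n - Suc k) * [:c:] * a)"
        by (simp only: nk power_Suc mult.assoc) (simp add: s_def)
      moreover have "(\<Lambda> (s ^ (n - k) * [:c:] * a) \<longlongrightarrow> 0) at_top"
        by (rule Suc.IH) (use Suc.prems in auto)
      ultimately show "((\<lambda>t. seq_eval (\<lambda>k. y k t) ((\<Prod>z\<leftarrow>[- 1]. [:- z, 1:]) * (s ^ (n - Suc k) * [:c:] * a))) \<longlongrightarrow> 0) at_top"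
        by (simp add: \<Lambda>_def)
    qed simp
    moreover have "s ^ (n - Suc k) * h * a = s ^ (n - k) * u * a + s ^ (n - Suc k) * [:c:] * a"
      unfolding h nk by (simp only: power_Suc) (simp add: algebra_simps)
    ultimately show ?case
      unfolding \<Lambda>_def by (simp only: seq_eval_add) (rule tendsto_add_zero)
  qed
  define h where "h = (s ^ n * p) mod q"
  have "q \<noteq> 0" using q by auto
  then have "degree h \<le> n"
    using degree_mod_less[of q "s ^ n * p"] by (auto simp: h_def n_def)
  then have "(\<Lambda> (h * a) \<longlongrightarrow> 0) at_top"
    using *[of n h] by simp
  moreover have "p = h * a + q * ((s ^ n * p) div q * a + b * p)"
  proof -
    have "p = (a * s ^ n + b * q) * p" by (simp add: ab)
    also have "\<dots> = s ^ n * p * a + b * q * p" by (simp add: algebra_simps)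
    also have "s ^ n * p = q * ((s ^ n * p) div q) + h" by (simp add: h_def)
    finally show ?thesis by (simp only: algebra_simps)
  qed
  then have "\<Lambda> p t = \<Lambda> (h * a) t" if "t \<ge> 0" for t
    using mod[OF that] by metis
  then have "eventually (\<lambda>t. \<Lambda> (h * a) t = \<Lambda> p t) at_top"
    using eventually_mono[OF eventually_ge_at_top[of 0]] by (metis (mono_tags, lifting))
  ultimately show ?thesis
    unfolding \<Lambda>_def[symmetric] by (auto simp: \<Lambda>_def intro: Lim_transform_eventually)
qed

section \<open>Flows of linear systems and tracking\<close>

lemma mult_mat_vec_index_sum:
  assumes "M \<in> carrier_mat k n" "v \<in> carrier_vec n" "i < k"
  shows "(M *\<^sub>v v) $ i = (\<Sum>j<n. M $$ (i, j) * v $ j)"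
  using assms by (auto simp: scalar_prod_def lessThan_atLeast0)

lemma flow_jet:
  assumes M: "M \<in> carrier_mat 1 n" and A: "A \<in> carrier_mat n n"
    and x: "ode_solution n (\<lambda>t v. A *\<^sub>v v) x"
  shows "jet (\<lambda>k t. complex_of_real (\<Sum>i<n. markov M A i k * x t $ i))"
  unfolding jet_def
proof (intro allI impI)
  fix k and t :: real assume t: "t \<ge> 0"
  have xt: "x t \<in> carrier_vec n"
    and d: "\<And>i. i < n \<Longrightarrow> ((\<lambda>\<tau>. x \<tau> $ i) has_real_derivative (A *\<^sub>v x t) $ i) (at t within {0..})"
    using x t by (auto simp: ode_solution_def)
  have "((\<lambda>t. \<Sum>i<n. markov M A i k * x t $ i) has_real_derivative
          (\<Sum>i<n. markov M A i k * (A *\<^sub>v x t) $ i)) (at t within {0..})"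
    by (intro DERIV_sum DERIV_cmult d) auto
  also have "(\<Sum>i<n. markov M A i k * (A *\<^sub>v x t) $ i)
      = (\<Sum>i<n. \<Sum>j<n. A $$ (i, j) * markov M A i k * x t $ j)"
    using A xt by (intro sum.cong refl) (auto simp: scalar_prod_def lessThan_atLeast0 sum_distrib_left mult_ac)
  also have "\<dots> = (\<Sum>j<n. markov M A j (Suc k) * x t $ j)"
    by (subst sum.swap) (simp add: markov_Suc[OF M A] sum_distrib_right)
  finally show "((\<lambda>t. complex_of_real (\<Sum>i<n. markov M A i k * x t $ i)) has_vector_derivative
      complex_of_real (\<Sum>i<n. markov M A i (Suc k) * x t $ i)) (at t within {0..})"
    by (intro has_vector_derivative_of_real) (simp add: has_real_derivative_iff_has_vector_derivative)
qed

lemma flow_char_poly_annihilates: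
  assumes M: "M \<in> carrier_mat 1 n" and A: "A \<in> carrier_mat n n"
  shows "seq_eval (\<lambda>k. complex_of_real (\<Sum>i<n. markov M A i k * x t $ i))
           (char_poly (map_mat complex_of_real A) * p) = 0"
proof -
  let ?q = "char_poly (map_mat complex_of_real A) * p"
  have "seq_eval (\<lambda>k. complex_of_real (markov M A i k)) ?q = 0" if "i < n" for i
    by (rule cayley_hamilton_seq[where u="\<lambda>i k. complex_of_real (markov M A i k)" and n=n])
       (use A that in \<open>auto simp: markov_Suc[OF M A]\<close>)
  moreover have "(\<lambda>k. complex_of_real (\<Sum>i<n. markov M A i k * x t $ i))
      = (\<lambda>k. \<Sum>i<n. complex_of_real (x t $ i) * complex_of_real (markov M A i k))"
    by (simp add: mult.commute)
  ultimately show ?thesis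
    by (simp add: seq_eval_lincomb)
qed

lemma char_poly_factors_over_cspectrum:
  assumes A: "A \<in> carrier_mat n n"
  obtains zs where "char_poly (map_mat complex_of_real A) = (\<Prod>z\<leftarrow>zs. [:- z, 1:])"
    and "set zs = cspectrum A"
proof -
  obtain zs where zs: "char_poly (map_mat complex_of_real A) = (\<Prod>z\<leftarrow>zs. [:- z, 1:])"
    using char_poly_factorized[of "map_mat complex_of_real A" n] A by auto
  moreover have "poly (\<Prod>z\<leftarrow>zs. [:- z, 1:]) w = 0 \<longleftrightarrow> w \<in> set zs" for w :: complex
    by (induction zs) auto
  ultimately show ?thesis
    using that[of zs] by (auto simp: cspectrum_eq[OF A] simp flip: of_real_hom.char_poly_hom[OF A])
qed

lemma markov_0:
  assumes "M \<in> carrier_mat 1 n" "A \<in> carrier_mat n n" "i < n"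
  shows "markov M A i 0 = M $$ (0, i)"
  using assms by (simp add: markov_def)

text \<open>
  By Cayley--Hamilton a linear output of the flow is annihilated by the product of the stable
  factors \<open>d/dt - z\<close> over the eigenvalues \<open>z\<close>; the zero signal trivially decays, and the factors
  can be removed.
\<close>

lemma stable_flow_tendsto_zero:
  assumes M: "M \<in> carrier_mat 1 n" and A: "A \<in> carrier_mat n n" and stable: "asymptotically_stable A"
    and x: "ode_solution n (\<lambda>t v. A *\<^sub>v v) x"
  shows "((\<lambda>t. \<Sum>i<n. M $$ (0, i) * x t $ i) \<longlongrightarrow> 0) at_top"
proof -
  let ?y = "\<lambda>k t. complex_of_real (\<Sum>i<n. markov M A i k * x t $ i)"
  obtain zs where zs: "char_poly (map_mat complex_of_real A) = (\<Prod>z\<leftarrow>zs. [:- z, 1:])"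
    "set zs = cspectrum A"
    using char_poly_factors_over_cspectrum[OF A] .
  have "((\<lambda>t. seq_eval (\<lambda>k. ?y k t) 1) \<longlongrightarrow> 0) at_top"
  proof (rule jet_cancel_stable_factors[OF flow_jet[OF M A x]])
    show "\<forall>z\<in>set zs. Re z < 0"
      using stable zs(2) by (simp add: asymptotically_stable_def)
    show "((\<lambda>t. seq_eval (\<lambda>k. ?y k t) ((\<Prod>z\<leftarrow>zs. [:- z, 1:]) * 1)) \<longlongrightarrow> 0) at_top"
      unfolding zs(1)[symmetric] flow_char_poly_annihilates[OF M A] by simp
  qed
  then show ?thesis
    by (simp add: markov_0[OF M A] tendsto_of_real_iff[of _ 0, simplified] flip: of_real_sum of_real_mult)
qed

text \<open>
  The modes of a marginally stable generator do not decay. If an output \<open>M \<omega>\<close> does, all its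
  derivatives decay, so every \<open>M S\<^sup>k \<omega>\<close> vanishes identically; at time \<open>0\<close> the row \<open>M\<close> is
  thus orthogonal to all \<open>S\<^sup>k \<omega>\<^sub>0\<close>, which span the space.
\<close>

lemma excited_output_eq_0:
  assumes M: "M \<in> carrier_mat 1 n" and S: "S \<in> carrier_mat n n" and imag: "\<forall>z\<in>cspectrum S. Re z = 0"
    and exc: "excitable S \<omega>\<^sub>0" and \<omega>\<^sub>0: "\<omega>\<^sub>0 \<in> carrier_vec n" and gen: "generator_trajectory S \<omega>\<^sub>0 \<omega>"
    and lim: "((\<lambda>t. \<Sum>i<n. M $$ (0, i) * \<omega> t $ i) \<longlongrightarrow> 0) at_top"
  shows "M = 0\<^sub>m 1 n"
proof -
  let ?y = "\<lambda>k t. complex_of_real (\<Sum>i<n. markov M S i k * \<omega> t $ i)"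
  have \<omega>: "\<omega> 0 = \<omega>\<^sub>0" "ode_solution n (\<lambda>t v. S *\<^sub>v v) \<omega>"
    using gen S by (auto simp: generator_trajectory_def)
  note jet = flow_jet[OF M S \<omega>(2)]
  note ann = flow_char_poly_annihilates[OF M S, of \<omega>]
  obtain zs where zs: "char_poly (map_mat complex_of_real S) = (\<Prod>z\<leftarrow>zs. [:- z, 1:])"
    "set zs = cspectrum S"
    using char_poly_factors_over_cspectrum[OF S] .
  have "poly (char_poly (map_mat complex_of_real S)) (-1) \<noteq> 0"
    using imag by (auto simp: cspectrum_eq[OF S] of_real_hom.char_poly_hom[OF S])
  moreover have "(?y 0 \<longlongrightarrow> 0) at_top"
    using tendsto_of_real[OF lim] by (simp add: markov_0[OF M S])
  ultimately have lim_all: "((\<lambda>t. seq_eval (\<lambda>k. ?y k t) p) \<longlongrightarrow> 0) at_top" for p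
    using ann by (intro jet_tendsto_zero_all[OF jet])
  have zero: "(\<Sum>i<n. markov M S i k * \<omega>\<^sub>0 $ i) = 0" for k
  proof -
    have "seq_eval (\<lambda>k. ?y k 0) (monom 1 k) = 0"
    proof (rule jet_cancel_imaginary_factors[OF jet])
      show "\<forall>z\<in>set zs. Re z = 0" using imag zs(2) by simp
    qed (use lim_all ann zs(1) in auto)
    moreover have "seq_eval (\<lambda>k. ?y k 0) (monom 1 k) = ?y k 0"
      by (simp add: seq_eval_def degree_monom_eq if_distrib[of "\<lambda>x. x * _"] cong: if_cong)
    ultimately have "?y k 0 = 0" by argo
    then show ?thesis by (simp only: of_real_eq_0_iff \<omega>(1))
  qed
  interpret vec_space "TYPE(real)" n .
  define K where "K = {S ^\<^sub>m k *\<^sub>v \<omega>\<^sub>0 | k. k < n}"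
  have "S ^\<^sub>m k *\<^sub>v \<omega>\<^sub>0 \<in> carrier_vec n" for k
    by (rule mult_mat_vec_carrier[OF pow_carrier_mat[OF S] \<omega>\<^sub>0])
  then have K: "K \<subseteq> carrier_vec n" by (auto simp: K_def)
  have "row M 0 \<bullet> (S ^\<^sub>m k *\<^sub>v \<omega>\<^sub>0) = 0" for k
  proof -
    have P: "S ^\<^sub>m k \<in> carrier_mat n n" using S by simp
    have "row M 0 \<bullet> (S ^\<^sub>m k *\<^sub>v \<omega>\<^sub>0) = (M *\<^sub>v (S ^\<^sub>m k *\<^sub>v \<omega>\<^sub>0)) $ 0"
      using M by simp
    also have "\<dots> = ((M * S ^\<^sub>m k) *\<^sub>v \<omega>\<^sub>0) $ 0"
      by (simp only: assoc_mult_mat_vec[OF M P \<omega>\<^sub>0])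
    also have "\<dots> = (\<Sum>i<n. markov M S i k * \<omega>\<^sub>0 $ i)"
      unfolding markov_def by (rule mult_mat_vec_index_sum[where k=1, OF _ \<omega>\<^sub>0]) (use M P in auto)
    finally show ?thesis using zero by simp
  qed
  then have "row M 0 \<in> orthogonal_complement K"
    using M by (auto simp: orthogonal_complement_def K_def)
  then have "row M 0 \<in> orthogonal_complement (span K)"
    using in_orthogonal_complement_span[OF K] by simp
  moreover have "span K = carrier_vec n"
    using exc S by (simp add: excitable_def K_def)
  ultimately have orth: "row M 0 \<bullet> v = 0" if "v \<in> carrier_vec n" for v
    using that by (simp add: orthogonal_complement_def)
  show ?thesis
  proof (rule eq_matI)
    fix i j assume "i < dim_row (0\<^sub>m 1 n :: real mat)" "j < dim_col (0\<^sub>m 1 n :: real mat)"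
    then have ij: "i = 0" "j < n" by auto
    have "row M 0 \<bullet> unit_vec n j = M $$ (0, j)"
      using M ij by (simp add: scalar_prod_right_unit[of _ n])
    with orth[of "unit_vec n j"] ij show "M $$ (i, j) = 0\<^sub>m 1 n $$ (i, j)" by simp
  qed (use M in auto)
qed

lemma ode_solution_mult_mat_derivative:
  assumes X: "X \<in> carrier_mat k n" and \<omega>: "ode_solution n f \<omega>" and f: "f t (\<omega> t) \<in> carrier_vec n"
    and i: "i < k" and t: "t \<ge> 0"
  shows "((\<lambda>\<tau>. (X *\<^sub>v \<omega> \<tau>) $ i) has_real_derivative (X *\<^sub>v f t (\<omega> t)) $ i) (at t within {0..})"
proof -
  have "((\<lambda>\<tau>. \<Sum>j<n. X $$ (i, j) * \<omega> \<tau> $ j) has_real_derivative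
          (\<Sum>j<n. X $$ (i, j) * f t (\<omega> t) $ j)) (at t within {0..})"
    using \<omega> t by (intro DERIV_sum DERIV_cmult) (auto simp: ode_solution_def)
  then have "((\<lambda>\<tau>. (X *\<^sub>v \<omega> \<tau>) $ i) has_real_derivative
          (\<Sum>j<n. X $$ (i, j) * f t (\<omega> t) $ j)) (at t within {0..})"
    by (rule has_field_derivative_transform_within[where d=1])
       (use t \<omega> in \<open>auto simp: ode_solution_def mult_mat_vec_index_sum[OF X _ i] simp del: index_mult_mat_vec\<close>)
  then show ?thesis
    by (simp add: mult_mat_vec_index_sum[OF X f i] del: index_mult_mat_vec)
qed

text \<open>
  \<open>X \<omega>\<close> is the steady state: it solves the driven equation, and every other solution
  differs from it by a solution of the stable homogeneous equation. The tracking error is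
  therefore \<open>(L - C X) \<omega>\<close> up to a vanishing transient. The steady state itself is an admissible
  trajectory, so tracking forces \<open>(L - C X) \<omega>\<close> to vanish at infinity.
\<close>

lemma tracking_iff_sylvester:
  assumes A: "A \<in> carrier_mat n n" and B: "B \<in> carrier_mat n 1" and C: "C \<in> carrier_mat 1 n"
    and stable: "asymptotically_stable A"
    and S: "S \<in> carrier_mat m m" and L: "L \<in> carrier_mat 1 m" and imag: "\<forall>z\<in>cspectrum S. Re z = 0"
    and exc: "excitable S \<omega>\<^sub>0" and \<omega>\<^sub>0: "\<omega>\<^sub>0 \<in> carrier_vec m" and gen: "generator_trajectory S \<omega>\<^sub>0 \<omega>"
    and r: "\<forall>t\<ge>0. r t = (L *\<^sub>v \<omega> t) $ 0"
    and X: "X \<in> carrier_mat n m" and syl: "A * X + B * L = X * S"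
  shows "asymptotically_tracks A B C 0 r \<longleftrightarrow> C * X = L"
proof -
  have \<omega>: "ode_solution m (\<lambda>t v. S *\<^sub>v v) \<omega>"
    using gen S by (auto simp: generator_trajectory_def)
  have \<omega>t: "\<omega> t \<in> carrier_vec m" if "t \<ge> 0" for t
    using \<omega> that by (simp add: ode_solution_def)
  have BL: "r t \<cdot>\<^sub>v col B 0 = B *\<^sub>v (L *\<^sub>v \<omega> t)" if "t \<ge> 0" for t
    using B L r that by (intro eq_vecI) (auto simp: scalar_prod_def)
  have XS: "X *\<^sub>v (S *\<^sub>v \<omega> t) = A *\<^sub>v (X *\<^sub>v \<omega> t) + r t \<cdot>\<^sub>v col B 0" if t: "t \<ge> 0" for t
  proof -
    have "X *\<^sub>v (S *\<^sub>v \<omega> t) = (A * X + B * L) *\<^sub>v \<omega> t"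
      by (simp only: syl assoc_mult_mat_vec[OF X S \<omega>t[OF t]])
    also have "\<dots> = (A * X) *\<^sub>v \<omega> t + (B * L) *\<^sub>v \<omega> t"
      by (rule add_mult_distrib_mat_vec[OF _ _ \<omega>t[OF t]]) (use A B L X in auto)
    also have "\<dots> = A *\<^sub>v (X *\<^sub>v \<omega> t) + r t \<cdot>\<^sub>v col B 0"
      by (simp only: BL[OF t] assoc_mult_mat_vec[OF A X \<omega>t[OF t]] assoc_mult_mat_vec[OF B L \<omega>t[OF t]])
    finally show ?thesis .
  qed
  have steady: "((\<lambda>\<tau>. (X *\<^sub>v \<omega> \<tau>) $ i) has_real_derivative (A *\<^sub>v (X *\<^sub>v \<omega> t) + r t \<cdot>\<^sub>v col B 0) $ i) (at t within {0..})"
    if "i < n" "t \<ge> 0" for i t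
    using ode_solution_mult_mat_derivative[OF X \<omega> _ that] S \<omega>t[OF that(2)] XS[OF that(2)] by simp
  have "C * X = L" if track: "asymptotically_tracks A B C 0 r"
  proof -
    have "ode_solution n (\<lambda>t v. A *\<^sub>v v + r t \<cdot>\<^sub>v col B 0) (\<lambda>t. X *\<^sub>v \<omega> t)"
      unfolding ode_solution_def using steady X \<omega>t by auto
    then have "((\<lambda>t. r t - ((C *\<^sub>v (X *\<^sub>v \<omega> t)) $ 0 + 0 * r t)) \<longlongrightarrow> 0) at_top"
      using track A X \<omega>t[of 0] unfolding asymptotically_tracks_def by auto
    moreover have "eventually (\<lambda>t. r t - ((C *\<^sub>v (X *\<^sub>v \<omega> t)) $ 0 + 0 * r t)
        = (\<Sum>i<m. (L - C * X) $$ (0, i) * \<omega> t $ i)) at_top"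
      using eventually_ge_at_top[of 0]
    proof eventually_elim
      case (elim t)
      have "(C *\<^sub>v (X *\<^sub>v \<omega> t)) $ 0 = ((C * X) *\<^sub>v \<omega> t) $ 0"
        by (simp only: assoc_mult_mat_vec[OF C X \<omega>t[OF elim]])
      also have "\<dots> = (\<Sum>i<m. (C * X) $$ (0, i) * \<omega> t $ i)"
        by (rule mult_mat_vec_index_sum[OF _ \<omega>t[OF elim]]) (use C X in auto)
      finally have "r t - ((C *\<^sub>v (X *\<^sub>v \<omega> t)) $ 0 + 0 * r t)
          = (\<Sum>i<m. L $$ (0, i) * \<omega> t $ i) - (\<Sum>i<m. (C * X) $$ (0, i) * \<omega> t $ i)"
        using r elim by (simp add: mult_mat_vec_index_sum[OF L \<omega>t[OF elim]] del: index_mult_mat_vec index_mult_mat)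
      also have "\<dots> = (\<Sum>i<m. (L $$ (0, i) - (C * X) $$ (0, i)) * \<omega> t $ i)"
        by (simp add: sum_subtractf left_diff_distrib)
      also have "\<dots> = (\<Sum>i<m. (L - C * X) $$ (0, i) * \<omega> t $ i)"
        using C X by (intro sum.cong refl) simp
      finally show ?case .
    qed
    ultimately have "((\<lambda>t. \<Sum>i<m. (L - C * X) $$ (0, i) * \<omega> t $ i) \<longlongrightarrow> 0) at_top"
      by (rule Lim_transform_eventually)
    then have zero: "L - C * X = 0\<^sub>m 1 m"
      by (intro excited_output_eq_0[OF _ S imag exc \<omega>\<^sub>0 gen]) (use C X L in auto)
    show "C * X = L"
    proof (rule eq_matI)
      fix i j assume ij: "i < dim_row L" "j < dim_col L"
      have "(L - C * X) $$ (i, j) = 0" using ij L zero by simp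
      then show "(C * X) $$ (i, j) = L $$ (i, j)" using ij C X L by simp
    qed (use C X L in auto)
  qed
  moreover have "asymptotically_tracks A B C 0 r" if CX: "C * X = L"
    unfolding asymptotically_tracks_def
  proof (intro ballI allI impI)
    fix x\<^sub>0 x assume "x 0 = x\<^sub>0 \<and> ode_solution (dim_row A) (\<lambda>t v. A *\<^sub>v v + r t \<cdot>\<^sub>v col B 0) x"
    then have x: "ode_solution n (\<lambda>t v. A *\<^sub>v v + r t \<cdot>\<^sub>v col B 0) x" using A by simp
    define \<xi> where "\<xi> = (\<lambda>t. x t - X *\<^sub>v \<omega> t)"
    have xt: "x t \<in> carrier_vec n" if "t \<ge> 0" for t
      using x that by (simp add: ode_solution_def)
    have Xt: "X *\<^sub>v \<omega> t \<in> carrier_vec n" if "t \<ge> 0" for t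
      using X \<omega>t[OF that] by simp
    have \<xi>: "ode_solution n (\<lambda>t v. A *\<^sub>v v) \<xi>"
      unfolding ode_solution_def
    proof (intro allI impI conjI)
      fix t :: real assume t: "t \<ge> 0"
      show "\<xi> t \<in> carrier_vec n" using xt[OF t] Xt[OF t] by (simp add: \<xi>_def)
      fix i assume i: "i < n"
      have "((\<lambda>\<tau>. x \<tau> $ i - (X *\<^sub>v \<omega> \<tau>) $ i) has_real_derivative
          (A *\<^sub>v x t + r t \<cdot>\<^sub>v col B 0) $ i - (A *\<^sub>v (X *\<^sub>v \<omega> t) + r t \<cdot>\<^sub>v col B 0) $ i) (at t within {0..})"
        using x t i by (intro DERIV_diff steady) (auto simp: ode_solution_def)
      moreover have "(A *\<^sub>v x t + r t \<cdot>\<^sub>v col B 0) $ i - (A *\<^sub>v (X *\<^sub>v \<omega> t) + r t \<cdot>\<^sub>v col B 0) $ i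
          = (A *\<^sub>v \<xi> t) $ i"
        unfolding \<xi>_def mult_minus_distrib_mat_vec[OF A xt[OF t] Xt[OF t]]
        using A B i by (simp del: index_mult_mat_vec)
      ultimately have "((\<lambda>\<tau>. x \<tau> $ i - (X *\<^sub>v \<omega> \<tau>) $ i) has_real_derivative (A *\<^sub>v \<xi> t) $ i) (at t within {0..})"
        by simp
      then show "((\<lambda>\<tau>. \<xi> \<tau> $ i) has_real_derivative (A *\<^sub>v \<xi> t) $ i) (at t within {0..})"
        by (rule has_field_derivative_transform_within[where d=1])
           (use X t i in \<open>auto simp: \<xi>_def simp del: index_mult_mat_vec\<close>)
    qed
    have "((\<lambda>t. - (\<Sum>i<n. C $$ (0, i) * \<xi> t $ i)) \<longlongrightarrow> 0) at_top"
      using tendsto_minus[OF stable_flow_tendsto_zero[OF C A stable \<xi>]] by simp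
    moreover have "eventually (\<lambda>t. - (\<Sum>i<n. C $$ (0, i) * \<xi> t $ i)
        = r t - ((C *\<^sub>v x t) $ 0 + 0 * r t)) at_top"
      using eventually_ge_at_top[of 0]
    proof eventually_elim
      case (elim t)
      have "\<xi> t \<in> carrier_vec n" using xt[OF elim] Xt[OF elim] by (simp add: \<xi>_def)
      then have "(\<Sum>i<n. C $$ (0, i) * \<xi> t $ i) = (C *\<^sub>v \<xi> t) $ 0"
        by (intro mult_mat_vec_index_sum[OF C, symmetric]) auto
      also have "C *\<^sub>v \<xi> t = C *\<^sub>v x t - (C * X) *\<^sub>v \<omega> t"
        by (simp only: \<xi>_def mult_minus_distrib_mat_vec[OF C xt[OF elim] Xt[OF elim]]
              assoc_mult_mat_vec[OF C X \<omega>t[OF elim]])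
      finally show ?case
        using r elim L C by (simp add: CX del: index_mult_mat_vec)
    qed
    ultimately show "((\<lambda>t. r t - ((C *\<^sub>v x t) $ 0 + 0 * r t)) \<longlongrightarrow> 0) at_top"
      by (rule Lim_transform_eventually)
  qed
  ultimately show ?thesis by blast
qed

section \<open>Equivalence of tracking and moment matching\<close>

theorem theorem7:
  fixes A B C :: "real mat" and P :: tf
    and A\<^sub>K B\<^sub>K C\<^sub>K :: "real mat" and D\<^sub>K :: real and K :: tf
    and P\<^sub>C\<^sub>L E :: tf
    and A\<^sub>W B\<^sub>W C\<^sub>W :: "real mat"
    and A\<^sub>E B\<^sub>E C\<^sub>E :: "real mat" and D\<^sub>E :: real
    and A\<^sub>R B\<^sub>R C\<^sub>R :: "real mat"
    and S L :: "real mat" and \<omega>\<^sub>0 :: "real vec" and \<omega> :: "real \<Rightarrow> real vec" and r :: "real \<Rightarrow> real"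
    and \<nu> :: nat
  assumes plant: "minimal_realization A B C 0 P"
    and controller: "realization A\<^sub>K B\<^sub>K C\<^sub>K D\<^sub>K K"
    and closed_loop: "P\<^sub>C\<^sub>L = P * K / (1 + P * K)"
    and sensitivity: "E = 1 / (1 + P * K)"
    and P\<^sub>C\<^sub>L_min: "minimal_realization A\<^sub>W B\<^sub>W C\<^sub>W 0 P\<^sub>C\<^sub>L"
    and P\<^sub>C\<^sub>L_stable: "asymptotically_stable A\<^sub>W"
    and E_min: "minimal_realization A\<^sub>E B\<^sub>E C\<^sub>E D\<^sub>E E"
    and E_stable: "asymptotically_stable A\<^sub>E"
    and R_realization: "realization A\<^sub>R B\<^sub>R C\<^sub>R 0 P\<^sub>C\<^sub>L"
    and R_stable: "asymptotically_stable A\<^sub>R"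
    and S_dim: "S \<in> carrier_mat \<nu> \<nu>" and L_dim: "L \<in> carrier_mat 1 \<nu>"
    and \<omega>\<^sub>0_dim: "\<omega>\<^sub>0 \<in> carrier_vec \<nu>" and \<omega>\<^sub>0_nonzero: "\<omega>\<^sub>0 \<noteq> 0\<^sub>v \<nu>"
    and S_imaginary: "\<forall>z\<in>cspectrum S. Re z = 0"
    and LS_observable: "observable L S"
    and S\<omega>\<^sub>0_excitable: "excitable S \<omega>\<^sub>0"
    and generator: "generator_trajectory S \<omega>\<^sub>0 \<omega>"
    and reference: "\<forall>t\<ge>0. r t = vec_index (L *\<^sub>v \<omega> t) 0"
    and dims: "tf_dim P\<^sub>C\<^sub>L = \<nu>" "tf_dim E = \<nu>"
  shows "(asymptotically_tracks A\<^sub>R B\<^sub>R C\<^sub>R 0 r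
            \<longleftrightarrow> C\<^sub>W * sylvester_solution A\<^sub>W B\<^sub>W S L = L) \<and>
         (C\<^sub>W * sylvester_solution A\<^sub>W B\<^sub>W S L = L
            \<longleftrightarrow> moments_vanish_at_spectrum E S)"
proof -
  have W: "A\<^sub>W \<in> carrier_mat (dim_row A\<^sub>W) (dim_row A\<^sub>W)" "B\<^sub>W \<in> carrier_mat (dim_row A\<^sub>W) 1"
      "C\<^sub>W \<in> carrier_mat 1 (dim_row A\<^sub>W)" "transfer_function A\<^sub>W B\<^sub>W C\<^sub>W 0 = P\<^sub>C\<^sub>L"
    using P\<^sub>C\<^sub>L_min by (auto simp: minimal_realization_def realization_def)
  have R: "A\<^sub>R \<in> carrier_mat (dim_row A\<^sub>R) (dim_row A\<^sub>R)" "B\<^sub>R \<in> carrier_mat (dim_row A\<^sub>R) 1"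
      "C\<^sub>R \<in> carrier_mat 1 (dim_row A\<^sub>R)" "transfer_function A\<^sub>R B\<^sub>R C\<^sub>R 0 = P\<^sub>C\<^sub>L"
    using R_realization by (auto simp: realization_def)
  define q\<^sub>W where "q\<^sub>W = char_poly A\<^sub>W - tf_numerator A\<^sub>W B\<^sub>W C\<^sub>W"
  define q\<^sub>R where "q\<^sub>R = char_poly A\<^sub>R - tf_numerator A\<^sub>R B\<^sub>R C\<^sub>R"
  note ne = char_poly_nonzero[OF W(1)] char_poly_nonzero[OF R(1)]
  have copW: "coprime (char_poly A\<^sub>W) (char_poly S)"
    by (rule coprime_char_poly_if_stable[OF W(1) S_dim P\<^sub>C\<^sub>L_stable S_imaginary])
  have copR: "coprime (char_poly A\<^sub>R) (char_poly S)"
    by (rule coprime_char_poly_if_stable[OF R(1) S_dim R_stable S_imaginary])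
  \<comment> \<open>If \<open>1 + P * K = 0\<close>, division by zero would give \<open>E = 0\<close>, whose dimension is \<open>0\<close>.\<close>
  have "\<nu> \<noteq> 0"
    using \<omega>\<^sub>0_dim \<omega>\<^sub>0_nonzero by auto
  then have "1 + P * K \<noteq> 0"
    using dims(2) sensitivity tf_dim_0 by auto
  then have E: "E = 1 - P\<^sub>C\<^sub>L"
    by (simp add: sensitivity closed_loop field_simps)
  have one_minus: "1 - Fract n d = Fract (d - n) d" if "d \<noteq> 0" for n d :: "real poly"
    using that by (simp add: One_fract_def)
  have EW: "E = Fract q\<^sub>W (char_poly A\<^sub>W)"
    using transfer_function_eq_Fract[OF W(1-3)] W(4) one_minus[OF ne(1)] by (simp add: E q\<^sub>W_def)
  have ER: "E = Fract q\<^sub>R (char_poly A\<^sub>R)"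
    using transfer_function_eq_Fract[OF R(1-3)] R(4) one_minus[OF ne(2)] by (simp add: E q\<^sub>R_def)
  \<comment> \<open>The numerators of \<open>E\<close> obtained from the two realizations differ only by factors without
      roots on the imaginary axis, so \<open>\<chi>\<^sub>S\<close> divides both or neither.\<close>
  have cross: "q\<^sub>W * char_poly A\<^sub>R = q\<^sub>R * char_poly A\<^sub>W"
    using EW ER ne by (simp add: eq_fract)
  have "char_poly S dvd q\<^sub>W \<longleftrightarrow> char_poly S dvd q\<^sub>W * char_poly A\<^sub>R"
    using copR by (simp add: coprime_dvd_mult_left_iff coprime_commute)
  also have "\<dots> \<longleftrightarrow> char_poly S dvd q\<^sub>R"
    unfolding cross using copW by (simp add: coprime_dvd_mult_left_iff coprime_commute)
  finally have WR: "char_poly S dvd q\<^sub>W \<longleftrightarrow> char_poly S dvd q\<^sub>R" .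
  have two: "C\<^sub>W * sylvester_solution A\<^sub>W B\<^sub>W S L = L \<longleftrightarrow> char_poly S dvd q\<^sub>W"
    using sylvester_moments_eq_iff_dvd[OF W(1-3) S_dim L_dim LS_observable copW]
    by (auto simp: q\<^sub>W_def)
  obtain X where X: "X \<in> carrier_mat (dim_row A\<^sub>R) \<nu>" "A\<^sub>R * X + B\<^sub>R * L = X * S"
      "C\<^sub>R * X = L \<longleftrightarrow> char_poly S dvd q\<^sub>R"
    using sylvester_moments_eq_iff_dvd[OF R(1-3) S_dim L_dim LS_observable copR]
    by (auto simp: q\<^sub>R_def)
  have one: "asymptotically_tracks A\<^sub>R B\<^sub>R C\<^sub>R 0 r \<longleftrightarrow> char_poly S dvd q\<^sub>R"
    using tracking_iff_sylvester[OF R(1-3) R_stable S_dim L_dim S_imaginary S\<omega>\<^sub>0_excitable \<omega>\<^sub>0_dim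
        generator reference X(1,2)] X(3) by simp
  have three: "moments_vanish_at_spectrum E S \<longleftrightarrow> char_poly S dvd q\<^sub>W"
    unfolding EW
    by (rule moments_vanish_at_spectrum_iff_dvd[OF S_dim])
       (rule stable_char_poly_nonzero_at_imaginary[OF W(1) P\<^sub>C\<^sub>L_stable S_imaginary])
  show ?thesis
    using one two three WR by blast
qed

end
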